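(* There is a positive constant $c>0$ such that $r_3(P_4,n) > 2^{cn}$, and for all integers $k \geq 4$ and $n>3k$: (1) $r_k(P_{k + 3}, n) \geq \mathrm{twr}_{k-1}(cn)$; (2) $r_k(P_{k + 2}, n) \geq \mathrm{twr}_{k - 1}(c\log^2 n)$; (3) $r_k(P_{k + 1}, n) \geq \mathrm{twr}_{k - 2}(cn^2)$.
   Context: $r_k(P_s,n)$ is the minimum $N$ such that every red-blue coloring of the $k$-element subsets of $[N]=\{1,\dots,N\}$ contains either a red tight path of size $s$ — vertices $v_1<\cdots<v_s$ in $[N]$ with $\{v_j,\dots,v_{j+k-1}\}$ red for every $j=1,\dots,s-k+1$ — or a set of $n$ vertices all of whose $k$-subsets are blue. The tower function is $\mathrm{twr}_1(x)=x$, $\mathrm{twr}_{i+1}(x)=2^{\mathrm{twr}_i(x)}$. *)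

theory Defs
  imports Complex_Main "HOL-Library.Ramsey"
begin

text \<open>
  A red-blue colouring of the \<open>k\<close>-subsets of \<open>{1..N}\<close> is given by the set
  \<open>R \<subseteq> [{1..N}]\<^bsup>k\<^esup>\<close> of red \<open>k\<close>-subsets; all other \<open>k\<close>-subsets are blue.
\<close>

text \<open>
  The upper bound \<open>s + 1 - k\<close> is the number \<open>s - k + 1\<close> of edges of the path when \<open>s \<ge> k\<close>, and
  it makes the range empty when \<open>s < k\<close>, despite truncated subtraction.
\<close>

definition tight_path :: "nat \<Rightarrow> nat \<Rightarrow> nat \<Rightarrow> nat set set \<Rightarrow> (nat \<Rightarrow> nat) \<Rightarrow> bool" where
  "tight_path k s N R v \<longleftrightarrow>
     strict_mono_on {1..s} v \<and> v ` {1..s} \<subseteq> {1..N} \<and>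
     (\<forall>j\<in>{1..s + 1 - k}. v ` {j..j + k - 1} \<in> R)"

definition path_clique_arrow :: "nat \<Rightarrow> nat \<Rightarrow> nat \<Rightarrow> nat \<Rightarrow> bool" where
  "path_clique_arrow k s n N \<longleftrightarrow>
     (\<forall>R \<subseteq> [{1..N}]\<^bsup>k\<^esup>. (\<exists>v. tight_path k s N R v) \<or> (\<exists>B \<in> [{1..N}]\<^bsup>n\<^esup>. [B]\<^bsup>k\<^esup> \<inter> R = {}))"

definition path_ramsey :: "nat \<Rightarrow> nat \<Rightarrow> nat \<Rightarrow> nat" where
  "path_ramsey k s n = (LEAST N. path_clique_arrow k s n N)"

text \<open>By Ramsey's theorem, the minimum is attained.\<close>

lemma path_clique_arrow_path_ramsey:
  assumes "k \<ge> 1"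
  shows "path_clique_arrow k s n (path_ramsey k s n)"
proof -
  obtain N :: nat where N: "partn_lst {..<N} [s, n] k"
    using ramsey_full by blast
  have "path_clique_arrow k s n N"
    unfolding path_clique_arrow_def
  proof (intro allI impI)
    fix R assume "R \<subseteq> [{1..N}]\<^bsup>k\<^esup>"
    define f where "f e = (if Suc ` e \<in> R then 0 else 1 :: nat)" for e
    have "f \<in> [{..<N}]\<^bsup>k\<^esup> \<rightarrow> {..<length [s, n]}"
      by (auto simp: f_def)
    then obtain i H where i: "i < 2" and H: "H \<in> [{..<N}]\<^bsup>([s, n] ! i)\<^esup>" and fH: "f ` [H]\<^bsup>k\<^esup> \<subseteq> {i}"
      using N unfolding partn_lst_def monochromatic_def by (force simp: numeral_2_eq_2)
    define B where "B = Suc ` H"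
    have BN: "B \<subseteq> {1..N}" "finite B" "card B = [s, n] ! i"
      using H by (auto simp: B_def nsets_def card_image)
    have fB: "f e = i \<and> Suc ` e = e'" if "e' \<in> [B]\<^bsup>k\<^esup>" and "e = (\<lambda>x. x - 1) ` e'" for e e'
    proof -
      have sub: "e' \<subseteq> Suc ` H" "finite e'" "card e' = k"
        using that(1) by (auto simp: nsets_def B_def)
      have im: "Suc ` e = e'"
      proof -
        have "Suc (x - 1) = x" if "x \<in> e'" for x
          using that sub(1) by auto
        then show ?thesis
          unfolding that(2) image_image by simp
      qed
      then have "card e = k"
        using sub(3) card_image[of Suc e] by simp
      moreover have "e \<subseteq> H" "finite e"
        using sub that(2) by auto
      ultimately show ?thesis
        using fH im by (auto simp: nsets_def)
    qed
    show "(\<exists>v. tight_path k s N R v) \<or> (\<exists>B \<in> [{1..N}]\<^bsup>n\<^esup>. [B]\<^bsup>k\<^esup> \<inter> R = {})"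
    proof (cases "i = 0")
      case True
      obtain h where h: "bij_betw h {..<card B} B" "strict_mono_on {..<card B} h"
        using ex_bij_betw_strict_mono_card BN(2) by metis
      define v where "v j = h (j - 1)" for j
      have s: "card B = s"
        using BN(3) True by simp
      have mono: "strict_mono_on {1..s} v"
        unfolding v_def using s by (intro strict_mono_onI strict_mono_onD[OF h(2)]) auto
      have vB: "v ` {1..s} \<subseteq> B"
      proof
        fix x assume "x \<in> v ` {1..s}"
        then obtain j where "x = h (j - 1)" "j - 1 \<in> {..<card B}"
          using s by (auto simp: v_def)
        then show "x \<in> B"
          using h(1) bij_betwE by blast
      qed
      have "v ` {j..j + k - 1} \<in> R" if j: "j \<in> {1..s + 1 - k}" for j
      proof -
        have sub: "{j..j + k - 1} \<subseteq> {1..s}"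
          using j assms by auto
        have "inj_on v {j..j + k - 1}"
          using mono sub by (meson inj_on_subset strict_mono_on_imp_inj_on)
        then have "card (v ` {j..j + k - 1}) = k"
          using j assms by (simp add: card_image)
        then have "v ` {j..j + k - 1} \<in> [B]\<^bsup>k\<^esup>"
          using vB sub by (auto simp: nsets_def)
        from fB[OF this refl] show ?thesis
          using True by (auto simp: f_def split: if_splits)
      qed
      then show ?thesis
        unfolding tight_path_def using mono vB BN(1) by blast
    next
      case False
      then have "B \<in> [{1..N}]\<^bsup>n\<^esup>"
        using BN i by (auto simp: nsets_def less_2_cases_iff)
      moreover have "e' \<notin> R" if "e' \<in> [B]\<^bsup>k\<^esup>" for e'
        using fB[OF that refl] False by (auto simp: f_def split: if_splits)
      ultimately show ?thesis by blast
    qed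
  qed
  then show ?thesis
    unfolding path_ramsey_def by (rule LeastI)
qed

text \<open>The tower function is indexed from \<open>1\<close>; its value at index \<open>0\<close> is a dummy.\<close>

fun twr :: "nat \<Rightarrow> real \<Rightarrow> real" where
  "twr 0 x = x"
| "twr (Suc 0) x = x"
| "twr (Suc (Suc i)) x = 2 powr twr (Suc i) x"

end

theory Submission
  imports Defs "HOL-Library.Sublist"
begin

text \<open>
  Colouring a \<open>(k - 1)\<close>-tuple by the length of the longest red tight path that ends in it shows that
  \<open>r\<^sub>k(P\<^bsub>k+q-1\<^esub>, n) > N\<close> holds iff some \<open>q\<close>-colouring \<open>\<chi>\<close> of the \<open>(k - 1)\<close>-subsets of an \<open>N\<close>-set
  has no \<open>n\<close>-subset on which \<open>\<chi>\<close> is non-increasing under shifting a tuple by one place.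
  This property is stepped up directly: a vertex set in \<open>{0..<2 ^ N}\<close> is described by the sequence
  of highest digits in which consecutive vertices differ, monotone sequences are coloured by \<open>\<chi>\<close>
  (reversed on decreasing ones), and the other ones according to where the sequence turns. A crude
  rule costs a factor \<open>3\<close> in \<open>n\<close> and is used for the first three steps only. From uniformity \<open>6\<close> on, a
  refined rule costs the additive constant \<open>3\<close>, and an exceptional set without increase is then
  a maximal one of the previous level inside a monotone run with one extra turn at each end.
  Since \<open>n > 3 k\<close> leaves no room for a loss of \<open>3\<close> in every step, the rule of every second step
  detects these exceptional sets, so that two steps together cost only \<open>5\<close>.
  The base colourings are random for \<open>q = 2\<close>, the stepping-up of a random graph for \<open>q = 4\<close>, and for
  \<open>q = 3\<close> the stepping-up of a random graph in which one colour is rare.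
\<close>

section \<open>Path-clique Ramsey numbers and shift-antimonotone sets\<close>

text \<open>The bounds need one \<open>c\<close> for all \<open>k\<close> and all
  \<open>n > 3 * k\<close>. A factor lost in every step would make \<open>c\<close> depend on
  \<open>k\<close>, so the losses have to add up to a fixed fraction of \<open>n\<close>: two steps
  raise \<open>3 * k\<close> by 6 and cost 5, which leaves at least \<open>n / 6\<close> for the
  base. The same uniformity demands colourings for \<open>n\<close> barely above
  \<open>3 * k\<close>, where the tower is already large at argument 0 and no asymptotic estimate
  applies. Non-increase is inherited by all windows of a list, so a set is excluded as soon as an
  earlier window has colour 0 and a later one colour \<open>q - 1\<close>; the colours of turns are
  arranged to produce such pairs. Reading a list backwards exchanges \<open>tl\<close> and
  \<open>butlast\<close>, which is why colours are complemented on decreasing sequences. The refined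
  rule has to tell apart turns at the first, an early, a late and the last place of a window. This
  takes windows of at least 6 entries, hence the three crude steps from 3 to 6.\<close>

definition shift_antimono :: "nat \<Rightarrow> (nat list \<Rightarrow> nat) \<Rightarrow> nat list \<Rightarrow> bool" where
  "shift_antimono j \<chi> vs \<longleftrightarrow>
     (\<forall>us. subseq us vs \<longrightarrow> length us = Suc j \<longrightarrow> \<chi> (tl us) \<le> \<chi> (butlast us))"

text \<open>Colourings are functions on strictly increasing lists; their values on other lists are junk.\<close>

definition avoidable :: "nat \<Rightarrow> nat \<Rightarrow> nat \<Rightarrow> nat \<Rightarrow> bool" where
  "avoidable q j n N \<longleftrightarrow>
     (\<exists>\<chi>. (\<forall>us. \<chi> us < q) \<and>
       (\<forall>vs. sorted_wrt (<) vs \<longrightarrow> set vs \<subseteq> {..<N} \<longrightarrow> length vs = n \<longrightarrow> \<not> shift_antimono j \<chi> vs))"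

lemma shift_antimono_subseq:
  "shift_antimono j \<chi> vs \<Longrightarrow> subseq us vs \<Longrightarrow> shift_antimono j \<chi> us"
  unfolding shift_antimono_def using subseq_order.order_trans by blast

lemma subseq_window: "subseq (take m (drop i vs)) vs"
  by (meson prefix_imp_subseq subseq_order.order_trans suffix_drop suffix_imp_subseq take_is_prefix)

lemma sorted_wrt_subseq:
  assumes "sorted_wrt P vs" "subseq us vs"
  shows "sorted_wrt P us"
  using assms(2,1)
proof (induction rule: list_emb.induct)
  case (list_emb_Cons2 x y xs ys)
  then show ?case using list_emb_set[of "(=)" xs ys] by auto
qed auto

lemma subseq_rev: "subseq xs ys \<Longrightarrow> subseq (rev xs) (rev ys)"
proof (induction rule: list_emb.induct)
  case (list_emb_Cons xs ys y)
  then show ?case using subseq_rev_drop_many by simp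
next
  case (list_emb_Cons2 x y xs ys)
  then show ?case by (simp add: list_emb_append_mono)
qed auto

lemma set_subseq: "subseq us vs \<Longrightarrow> set us \<subseteq> set vs"
  by (metis notin_set_nthsI subseq_conv_nths subsetI)

text \<open>Neighbouring windows are the \<open>butlast\<close> and the \<open>tl\<close> of one
  window with an additional entry, so the colour cannot rise while a window slides to the
  right.\<close>

lemma windows_antimono:
  assumes "shift_antimono j \<chi> vs" "i \<le> i'" "i' + j \<le> length vs"
  shows "\<chi> (take j (drop i' vs)) \<le> \<chi> (take j (drop i vs))"
  using assms(2,3)
proof (induction rule: dec_induct)
  case (step m)
  let ?us = "take (Suc j) (drop m vs)"
  have "length ?us = Suc j" using step by simp
  moreover have "tl ?us = take j (drop (Suc m) vs)"
    by (simp add: tl_take tl_drop drop_Suc)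
  moreover have "butlast ?us = take j (drop m vs)"
    using step by (simp add: butlast_take)
  ultimately have "\<chi> (take j (drop (Suc m) vs)) \<le> \<chi> (take j (drop m vs))"
    using assms(1) subseq_window unfolding shift_antimono_def by metis
  then show ?case using step by simp
qed simp

lemma avoidable_mono:
  assumes "avoidable q j n N" "n \<le> n'" "N' \<le> N"
  shows "avoidable q j n' N'"
proof -
  obtain \<chi> where \<chi>: "\<And>us. \<chi> us < q"
    "\<And>vs. sorted_wrt (<) vs \<Longrightarrow> set vs \<subseteq> {..<N} \<Longrightarrow> length vs = n \<Longrightarrow> \<not> shift_antimono j \<chi> vs"
    using assms(1) unfolding avoidable_def by blast
  have "\<not> shift_antimono j \<chi> vs"
    if vs: "sorted_wrt (<) vs" "set vs \<subseteq> {..<N'}" "length vs = n'" for vs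
  proof
    assume "shift_antimono j \<chi> vs"
    then have "shift_antimono j \<chi> (take n vs)"
      using subseq_window[of n 0 vs] shift_antimono_subseq by simp
    moreover have "set (take n vs) \<subseteq> {..<N}"
      using vs(2) assms(3) set_take_subset[of n vs] by fastforce
    ultimately show False
      using \<chi>(2)[of "take n vs"] vs assms(2) by (simp add: sorted_wrt_take)
  qed
  then show ?thesis using \<chi>(1) unfolding avoidable_def by blast
qed

lemma sorted_list_length_le:
  assumes "sorted_wrt (<) vs" "set vs \<subseteq> {..<N::nat}"
  shows "length vs \<le> N"
proof -
  have "distinct vs" using assms(1) strict_sorted_iff by blast
  then have "length vs = card (set vs)" by (simp add: distinct_card)
  also have "\<dots> \<le> N" using card_mono[OF _ assms(2)] by simp
  finally show ?thesis .
qed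

lemma avoidable_trivial:
  assumes "N < n" "0 < q"
  shows "avoidable q j n N"
  unfolding avoidable_def
  using assms by (intro exI[of _ "\<lambda>_. 0"]) (auto dest: sorted_list_length_le)

lemma avoidable_colours_mono: "avoidable q j n N \<Longrightarrow> q \<le> q' \<Longrightarrow> avoidable q' j n N"
  unfolding avoidable_def by (meson order_less_le_trans)

text \<open>An edge is declared red when the colour rises strictly from its first \<open>j\<close>
  to its last \<open>j\<close> vertices. The \<open>q\<close> edges of a tight path on
  \<open>j + q\<close> vertices would need \<open>q + 1\<close> increasing colours, and a set
  without red edges is antimonotone.\<close>

lemma path_ramsey_greater:
  assumes "avoidable q j n N" "j \<ge> 1"
  shows "N < path_ramsey (Suc j) (j + q) n"
proof (rule ccontr)
  define M where "M = path_ramsey (Suc j) (j + q) n"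
  assume "\<not> N < path_ramsey (Suc j) (j + q) n"
  then have "avoidable q j n M" using avoidable_mono[OF assms(1)] by (simp add: M_def)
  then obtain \<chi> where \<chi>: "\<And>us. \<chi> us < q"
    "\<And>vs. sorted_wrt (<) vs \<Longrightarrow> set vs \<subseteq> {..<M} \<Longrightarrow> length vs = n \<Longrightarrow> \<not> shift_antimono j \<chi> vs"
    unfolding avoidable_def by blast
  have arrow: "path_clique_arrow (Suc j) (j + q) n M"
    unfolding M_def by (rule path_clique_arrow_path_ramsey) simp
  \<comment> \<open>The shift by one passes from the ground set \<open>{1..M}\<close> of the
    hypergraph to \<open>{..<M}\<close>.\<close>
  define L where "L e = map (\<lambda>x. x - 1) (sorted_list_of_set e)" for e :: "nat set"
  define R where "R = {e \<in> [{1..M}]\<^bsup>Suc j\<^esup>. \<chi> (butlast (L e)) < \<chi> (tl (L e))}"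
  have "R \<subseteq> [{1..M}]\<^bsup>Suc j\<^esup>" unfolding R_def by blast
  with arrow consider v where "tight_path (Suc j) (j + q) M R v"
    | B where "B \<in> [{1..M}]\<^bsup>n\<^esup>" "[B]\<^bsup>Suc j\<^esup> \<inter> R = {}"
    unfolding path_clique_arrow_def by blast
  then show False
  proof cases
    case 1
    then have mono: "strict_mono_on {1..j + q} v"
      and red: "\<And>i. i \<in> {1..q} \<Longrightarrow> v ` {i..i + j} \<in> R"
      unfolding tight_path_def by auto
    define W where "W i = map (\<lambda>t. v t - 1) [i..<i + j]" for i
    \<comment> \<open>Windows are numbered from 1, so \<open>W (Suc i)\<close> comes after
      \<open>i\<close> strict rises; the case \<open>i = q\<close> is the contradiction.\<close>
    have "i \<le> \<chi> (W (Suc i))" if "i \<le> q" for i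
      using that
    proof (induction i)
      case (Suc i)
      have "sorted_wrt (<) (map v [Suc i..<Suc i + Suc j])"
        unfolding sorted_wrt_map
        by (rule sorted_wrt_mono_rel[of _ "(<)", OF _ sorted_wrt_upt])
           (use Suc.prems in \<open>auto intro!: strict_mono_onD[OF mono] simp del: upt_Suc\<close>)
      moreover have "set (map v [Suc i..<Suc i + Suc j]) = v ` {Suc i..Suc i + j}"
        by (simp add: atLeastLessThanSuc_atLeastAtMost del: upt_Suc)
      ultimately have "sorted_list_of_set (v ` {Suc i..Suc i + j}) = map v [Suc i..<Suc i + Suc j]"
        by (metis sorted_list_of_set.idem_if_sorted_distinct strict_sorted_iff)
      then have L: "L (v ` {Suc i..Suc i + j}) = map (\<lambda>t. v t - 1) [Suc i..<Suc i + Suc j]"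
        by (simp add: L_def comp_def del: upt_Suc)
      have "butlast (L (v ` {Suc i..Suc i + j})) = W (Suc i)"
        unfolding L W_def by (simp flip: map_butlast)
      moreover have "tl (L (v ` {Suc i..Suc i + j})) = W (Suc (Suc i))"
        unfolding L W_def by (subst upt_conv_Cons) (simp_all del: upt_Suc)
      ultimately have "\<chi> (W (Suc i)) < \<chi> (W (Suc (Suc i)))"
        using red[of "Suc i"] Suc.prems by (auto simp: R_def)
      then show ?case using Suc by simp
    qed simp
    then show False using \<chi>(1) by (meson le_refl not_le)
  next
    case 2
    define vs where "vs = L B"
    have B: "finite B" "card B = n" "B \<subseteq> {1..M}" using 2(1) by (auto simp: nsets_def)
    have sB: "sorted_wrt (<) (sorted_list_of_set B)" by simp
    have pred: "sorted_wrt (<) (map (\<lambda>x. x - 1) xs)"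
      if "sorted_wrt (<) xs" "set xs \<subseteq> {1..M}" for xs
      unfolding sorted_wrt_map
      by (rule sorted_wrt_mono_rel[OF _ that(1)]) (use that(2) in force)
    have "sorted_wrt (<) vs" unfolding vs_def L_def by (rule pred) (use B in auto)
    moreover have "set vs \<subseteq> {..<M}" using B by (force simp: vs_def L_def)
    moreover have "length vs = n" using B by (simp add: vs_def L_def)
    moreover have "shift_antimono j \<chi> vs"
      unfolding shift_antimono_def
    proof (intro allI impI)
      fix us assume us: "subseq us vs" "length us = Suc j"
      obtain ws where ws: "subseq ws (sorted_list_of_set B)" "us = map (\<lambda>x. x - 1) ws"
      proof -
        obtain I where "us = nths vs I" using us(1) subseq_conv_nths by blast
        then have "us = map (\<lambda>x. x - 1) (nths (sorted_list_of_set B) I)"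
          by (simp add: vs_def L_def nths_map)
        then show ?thesis using that subseq_conv_nths by blast
      qed
      have sw: "sorted_wrt (<) ws" using ws(1) sB sorted_wrt_subseq by blast
      have "set ws \<subseteq> B" using set_subseq[OF ws(1)] B by simp
      moreover have "card (set ws) = Suc j"
        using sw ws(2) us(2) by (metis distinct_card length_map strict_sorted_iff)
      ultimately have "set ws \<in> [B]\<^bsup>Suc j\<^esup>" "set ws \<in> [{1..M}]\<^bsup>Suc j\<^esup>"
        using B by (auto simp: nsets_def)
      moreover have "L (set ws) = us"
        using sw ws(2) by (metis L_def sorted_list_of_set.idem_if_sorted_distinct strict_sorted_iff)
      ultimately show "\<chi> (tl us) \<le> \<chi> (butlast us)"
        using 2(2) by (auto simp: R_def)
    qed
    ultimately show False using \<chi>(2) by blast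
  qed
qed

text \<open>\<open>delta x y\<close> is the position of the highest binary digit in which \<open>x\<close> and \<open>y\<close> differ.\<close>

definition delta :: "nat \<Rightarrow> nat \<Rightarrow> nat" where
  "delta x y = (LEAST i. x div 2 ^ Suc i = y div 2 ^ Suc i)"

text \<open>Numbers that agree after removal of some lowest digits also agree after removal of more,
  so the \<open>LEAST\<close> is a threshold. The next three lemmas argue with these quotients
  instead of digits.\<close>

lemma delta_le_iff: "delta x y \<le> i \<longleftrightarrow> x div 2 ^ Suc i = y div 2 ^ Suc i"
proof -
  have ex: "x div 2 ^ Suc (x + y) = y div 2 ^ Suc (x + y)"
  proof -
    have "x < 2 ^ Suc (x + y)" "y < 2 ^ Suc (x + y)"
      using less_exp[of "Suc (x + y)"] by linarith+
    then show ?thesis by simp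
  qed
  have up: "x div 2 ^ Suc l = y div 2 ^ Suc l"
    if "x div 2 ^ Suc m = y div 2 ^ Suc m" "m \<le> l" for m l
  proof -
    have "(2::nat) ^ Suc l = 2 ^ Suc m * 2 ^ (l - m)"
      using that(2) by (simp flip: power_add)
    then show ?thesis using that(1) by (simp only: div_mult2_eq)
  qed
  show ?thesis
  proof
    assume "delta x y \<le> i"
    moreover have "x div 2 ^ Suc (delta x y) = y div 2 ^ Suc (delta x y)"
      unfolding delta_def by (rule LeastI[of "\<lambda>i. x div 2 ^ Suc i = y div 2 ^ Suc i", OF ex])
    ultimately show "x div 2 ^ Suc i = y div 2 ^ Suc i" using up by blast
  next
    assume "x div 2 ^ Suc i = y div 2 ^ Suc i"
    then show "delta x y \<le> i" unfolding delta_def by (rule Least_le)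
  qed
qed

text \<open>Division is monotone, so the quotient of \<open>y\<close> lies between those of
  \<open>x\<close> and \<open>z\<close> and is squeezed when these coincide.\<close>

lemma delta_max:
  assumes "x < y" "y < z"
  shows "delta x z = max (delta x y) (delta y z)"
proof -
  have "delta x z \<le> i \<longleftrightarrow> max (delta x y) (delta y z) \<le> i" for i
  proof -
    have "x div 2 ^ Suc i \<le> y div 2 ^ Suc i" "y div 2 ^ Suc i \<le> z div 2 ^ Suc i"
      using assms by (simp_all add: div_le_mono)
    then show ?thesis unfolding max.bounded_iff delta_le_iff by linarith
  qed
  then show ?thesis by (meson le_refl order_antisym)
qed

text \<open>If both steps had the same top digit \<open>i\<close>, the quotients by
  \<open>2 ^ i\<close> would be three different numbers with the same half.\<close>

lemma delta_neq:
  assumes "x < y" "y < z"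
  shows "delta x y \<noteq> delta y z"
proof
  define i where "i = delta x y"
  assume eq: "delta x y = delta y z"
  have split: "a < b \<Longrightarrow> delta a b = i \<Longrightarrow> a div 2 ^ i < b div 2 ^ i" for a b :: nat
  proof (cases i)
    case (Suc m)
    assume "a < b" "delta a b = i"
    then have "\<not> delta a b \<le> m" using Suc by simp
    then have "a div 2 ^ i \<noteq> b div 2 ^ i" unfolding delta_le_iff Suc .
    then show ?thesis using \<open>a < b\<close> by (simp add: div_le_mono le_neq_implies_less)
  qed auto
  have "x div 2 ^ i < y div 2 ^ i" "y div 2 ^ i < z div 2 ^ i"
    using split assms eq i_def by auto
  moreover have "x div 2 ^ i div 2 = z div 2 ^ i div 2"
  proof -
    have "x div 2 ^ Suc i = z div 2 ^ Suc i"
      using delta_le_iff[of x z i] delta_max[OF assms] eq i_def by simp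
    then show ?thesis by (simp only: power_Suc2 div_mult2_eq)
  qed
  ultimately show False by linarith
qed

lemma delta_less:
  assumes "x < y" "y < 2 ^ N"
  shows "delta x y < N"
proof (cases N)
  case (Suc m)
  then have "delta x y \<le> m" using assms delta_le_iff[of x y m] by simp
  then show ?thesis using Suc by simp
qed (use assms in simp)

fun deltas :: "nat list \<Rightarrow> nat list" where
  "deltas (x # y # zs) = delta x y # deltas (y # zs)"
| "deltas _ = []"

lemma length_deltas [simp]: "length (deltas vs) = length vs - 1"
  by (induction vs rule: deltas.induct) auto

lemma nth_deltas: "Suc i < length vs \<Longrightarrow> deltas vs ! i = delta (vs ! i) (vs ! Suc i)"
proof (induction vs arbitrary: i rule: deltas.induct)
  case (1 x y zs)
  then show ?case by (cases i) auto
qed auto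

lemma deltas_take: "deltas (take (Suc i) vs) = take i (deltas vs)"
proof (rule nth_equalityI)
  fix k assume "k < length (deltas (take (Suc i) vs))"
  then show "deltas (take (Suc i) vs) ! k = take i (deltas vs) ! k"
    by (subst nth_deltas) (auto simp: nth_deltas)
qed auto

lemma deltas_drop: "deltas (drop i vs) = drop i (deltas vs)"
proof (rule nth_equalityI)
  fix k assume "k < length (deltas (drop i vs))"
  then show "deltas (drop i vs) ! k = drop i (deltas vs) ! k"
    by (subst nth_deltas) (auto simp: nth_deltas)
qed auto

lemma deltas_window: "deltas (take (Suc m) (drop i vs)) = take m (drop i (deltas vs))"
  by (simp add: deltas_take deltas_drop)

lemma deltas_tl: "deltas (tl vs) = tl (deltas vs)"
  using deltas_drop[of "Suc 0" vs] by (simp add: drop_Suc)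

lemma deltas_butlast: "deltas (butlast vs) = butlast (deltas vs)"
proof (rule nth_equalityI)
  fix k assume "k < length (deltas (butlast vs))"
  then show "deltas (butlast vs) ! k = butlast (deltas vs) ! k"
    by (subst nth_deltas) (auto simp: nth_deltas nth_butlast)
qed auto

lemma set_deltas:
  assumes "sorted_wrt (<) vs" "set vs \<subseteq> {..<2 ^ N}"
  shows "set (deltas vs) \<subseteq> {..<N}"
proof
  fix d assume "d \<in> set (deltas vs)"
  then obtain i where i: "Suc i < length vs" "d = delta (vs ! i) (vs ! Suc i)"
    by (auto simp: in_set_conv_nth nth_deltas less_diff_conv)
  then have "vs ! i < vs ! Suc i" "vs ! Suc i < 2 ^ N"
    using subsetD[OF assms(2) nth_mem[OF i(1)]] sorted_wrt_nth_less[OF assms(1)] i(1) by auto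
  then show "d \<in> {..<N}" using delta_less i by simp
qed

lemma deltas_neq:
  assumes "sorted_wrt (<) vs" "Suc (Suc i) < length vs"
  shows "deltas vs ! i \<noteq> deltas vs ! Suc i"
  using assms by (simp add: nth_deltas delta_neq sorted_wrt_nth_less)

section \<open>Highest differing digits and the lossy step\<close>

lemma delta_bound:
  assumes "sorted_wrt (<) vs" "\<And>d. d \<in> set (deltas vs) \<Longrightarrow> d < m" "x \<in> set vs" "y \<in> set vs" "x < y"
  shows "delta x y < m"
proof -
  have step: "delta (vs ! i) (vs ! Suc i) < m" if "Suc i < length vs" for i
  proof -
    have "deltas vs ! i \<in> set (deltas vs)" using that by (intro nth_mem) simp
    then show ?thesis using assms(2) that by (simp add: nth_deltas)
  qed
  have *: "delta (vs ! a) (vs ! b) < m" if "Suc a \<le> b" "b < length vs" for a b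
    using that
  proof (induction b rule: dec_induct)
    case (step b)
    then have "vs ! a < vs ! b" "vs ! b < vs ! Suc b"
      using assms(1) by (simp_all add: sorted_wrt_nth_less)
    then have "delta (vs ! a) (vs ! Suc b) = max (delta (vs ! a) (vs ! b)) (delta (vs ! b) (vs ! Suc b))"
      by (rule delta_max)
    then show ?case using step \<open>\<And>i. Suc i < length vs \<Longrightarrow> delta (vs ! i) (vs ! Suc i) < m\<close> by simp
  qed (use step in simp)
  obtain a b where ab: "a < length vs" "x = vs ! a" "b < length vs" "y = vs ! b"
    using assms(3,4) by (metis in_set_conv_nth)
  then have "a < b" using assms(1,5)
    by (metis linorder_neqE_nat order_less_asym sorted_wrt_nth_less)
  then show ?thesis using * ab by simp
qed

text \<open>By \<open>delta_max\<close>, \<open>delta\<close> between a vertex and any later one is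
  that of the first step between them, the largest. Hence the left ends of the selected steps
  together with the last vertex realise \<open>es\<close>. The clauses on \<open>last\<close> and
  \<open>hd\<close> allow attaching further vertices at an end without changing the adjoining
  \<open>delta\<close>.\<close>

lemma select_decreasing:
  assumes "vs \<noteq> []" "sorted_wrt (<) vs" "sorted_wrt (>) (deltas vs)" "subseq es (deltas vs)"
  shows "\<exists>us. subseq us vs \<and> us \<noteq> [] \<and> deltas us = es \<and> last us = last vs \<and>
    (es \<noteq> [] \<longrightarrow> hd es = hd (deltas vs) \<longrightarrow> hd us = hd vs)"
  using assms
proof (induction vs arbitrary: es rule: deltas.induct)
  case (1 x y zs)
  have desc: "\<And>d. d \<in> set (deltas (y # zs)) \<Longrightarrow> d < delta x y"
    using 1 by simp
  have IH: "\<exists>us. subseq us (y # zs) \<and> us \<noteq> [] \<and> deltas us = es \<and> last us = last (y # zs)"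
    if "subseq es (deltas (y # zs))" for es
    using "1.IH"[OF _ _ _ that] "1.prems" by auto
  show ?case
  proof (cases "subseq es (deltas (y # zs))")
    case True
    then obtain us where us: "subseq us (y # zs)" "us \<noteq> []" "deltas us = es" "last us = last (y # zs)"
      using IH by blast
    have "hd es \<noteq> delta x y" if "es \<noteq> []"
      using desc set_subseq[OF True] hd_in_set[OF that] by fastforce
    then show ?thesis using us by (intro exI[of _ us]) auto
  next
    case False
    then obtain es' where es': "es = delta x y # es'" "subseq es' (deltas (y # zs))"
      using 1(5) by (auto elim: list_emb.cases)
    then obtain us where us: "subseq us (y # zs)" "us \<noteq> []" "deltas us = es'" "last us = last (y # zs)"
      using IH by blast
    obtain u us' where u: "us = u # us'" using us(2) by (cases us) auto
    have "u \<in> set (y # zs)" using set_subseq[OF us(1)] u by auto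
    then have "delta x u = delta x y"
    proof (cases "u = y")
      case False
      then have yu: "y < u" using \<open>u \<in> set (y # zs)\<close> 1(3) by auto
      then have "delta y u < delta x y"
        using delta_bound[of "y # zs" "delta x y" y u] desc 1(3) \<open>u \<in> set (y # zs)\<close> by auto
      then show ?thesis using delta_max[of x y u] yu 1(3) by simp
    qed simp
    then have "deltas (x # us) = es" using es' us u by simp
    then show ?thesis using us by (intro exI[of _ "x # us"]) auto
  qed
next
  case ("2_2" v)
  then have "es = []" by simp
  then show ?case by (intro exI[of _ "[v]"]) auto
qed simp

lemma deltas_snoc: "deltas (vs @ [x, y]) = deltas (vs @ [x]) @ [delta x y]"
proof (induction vs)
  case (Cons a vs)
  then show ?case by (cases vs) auto
qed simp

text \<open>Mirror image of the decreasing case: now the last step dominates, so the first vertex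
  and the right ends of the selected steps are kept.\<close>

lemma select_increasing:
  assumes "vs \<noteq> []" "sorted_wrt (<) vs" "sorted_wrt (<) (deltas vs)" "subseq es (deltas vs)"
  shows "\<exists>us. subseq us vs \<and> us \<noteq> [] \<and> deltas us = es \<and> hd us = hd vs \<and>
    (es \<noteq> [] \<longrightarrow> last es = last (deltas vs) \<longrightarrow> last us = last vs)"
  using assms
proof (induction vs arbitrary: es rule: rev_induct)
  case (snoc y vs)
  show ?case
  proof (cases vs rule: rev_cases)
    case Nil
    then have "es = []" using snoc.prems(4) by simp
    then show ?thesis using Nil by (intro exI[of _ "[y]"]) auto
  next
    case vs: (snoc ws x)
    have D: "deltas (vs @ [y]) = deltas vs @ [delta x y]" by (simp add: vs deltas_snoc)
    have asc: "\<And>d. d \<in> set (deltas vs) \<Longrightarrow> d < delta x y" and inc: "sorted_wrt (<) (deltas vs)"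
      using snoc.prems(3) by (auto simp: D sorted_wrt_append)
    have sv: "sorted_wrt (<) vs" "\<And>u. u \<in> set vs \<Longrightarrow> u < y"
      using snoc.prems(2) by (auto simp: sorted_wrt_append)
    obtain es1 es2 where es: "es = es1 @ es2" "subseq es1 (deltas vs)" "subseq es2 [delta x y]"
      using snoc.prems(4) D by (metis subseq_appendE)
    obtain us where us: "subseq us vs" "us \<noteq> []" "deltas us = es1" "hd us = hd vs"
      using snoc.IH[OF _ sv(1) inc es(2)] vs by auto
    consider "es2 = []" | "es2 = [delta x y]"
      using es(3) by (auto elim!: list_emb.cases)
    then show ?thesis
    proof cases
      case 1
      have "last es \<noteq> delta x y" if "es \<noteq> []"
        using asc set_subseq[OF es(2)] last_in_set[OF that] es(1) 1 by fastforce
      moreover have "subseq us (vs @ [y])" using us(1) by (rule subseq_rev_drop_many)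
      moreover have "hd (vs @ [y]) = hd vs" using vs by (cases ws) simp_all
      ultimately show ?thesis using us es 1 D by (intro exI[of _ us]) auto
    next
      case 2
      let ?u = "last us"
      have u: "?u \<in> set vs" using set_subseq[OF us(1)] us(2) by auto
      then have "delta ?u y = delta x y"
      proof (cases "?u = x")
        case False
        then have ux: "?u < x" using u sv(1) vs by (auto simp: sorted_wrt_append)
        then have "delta ?u x < delta x y"
          using delta_bound[OF sv(1), of "delta x y" ?u x] asc u vs by auto
        then show ?thesis using delta_max[of ?u x y] ux sv(2)[of x] vs by simp
      qed simp
      moreover have "us = butlast us @ [?u]" using us(2) by simp
      ultimately have "deltas (us @ [y]) = es"
        using us(3) es(1) 2 deltas_snoc[of "butlast us" ?u y]
        by (metis append.assoc append_Cons append_Nil)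
      moreover have "hd (vs @ [y]) = hd vs" using vs by (cases ws) simp_all
      ultimately show ?thesis using us
        by (intro exI[of _ "us @ [y]"]) (auto simp: list_emb_append_mono)
    qed
  qed
qed simp

lemma subseq_tl: "subseq (tl xs) xs"
  by (rule suffix_imp_subseq) (rule suffix_tl)

lemma subseq_butlast: "subseq (butlast xs) xs"
  by (rule prefix_imp_subseq) (rule prefixeq_butlast)

definition monotone_list :: "nat list \<Rightarrow> bool" where
  "monotone_list D \<longleftrightarrow> sorted_wrt (<) D \<or> sorted_wrt (>) D"

lemma select_monotone:
  assumes "vs \<noteq> []" "sorted_wrt (<) vs" "monotone_list (deltas vs)" "subseq es (deltas vs)" "es \<noteq> []"
  obtains us where "subseq us vs" "us \<noteq> []" "deltas us = es"
    "hd es = hd (deltas vs) \<longrightarrow> hd us = hd vs" "last es = last (deltas vs) \<longrightarrow> last us = last vs"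
  using select_decreasing[of vs es] select_increasing[of vs es] assms
  unfolding monotone_list_def by metis

lemma increasing_run:
  assumes "shift_antimono (Suc j) (\<lambda>us. F (deltas us)) vs"
    and "sorted_wrt (<) vs" "sorted_wrt (<) (deltas vs)"
    and "\<And>D. sorted_wrt (<) D \<Longrightarrow> length D = j \<Longrightarrow> F D = \<chi> D"
  shows "shift_antimono j \<chi> (deltas vs)"
  unfolding shift_antimono_def
proof (intro allI impI)
  fix D assume D: "subseq D (deltas vs)" "length D = Suc j"
  then have "vs \<noteq> []" by auto
  then obtain us where us: "subseq us vs" "us \<noteq> []" "deltas us = D"
    using select_increasing[OF _ assms(2,3) D(1)] by auto
  have sD: "sorted_wrt (<) D" using assms(3) D(1) sorted_wrt_subseq by blast
  have "length us = Suc (Suc j)" using us D(2) by (cases us) auto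
  then have "F (tl D) \<le> F (butlast D)"
    using assms(1) us unfolding shift_antimono_def by (metis deltas_tl deltas_butlast)
  moreover have "sorted_wrt (<) (tl D)" "sorted_wrt (<) (butlast D)"
    using sD sorted_wrt_subseq subseq_tl subseq_butlast by blast+
  ultimately show "\<chi> (tl D) \<le> \<chi> (butlast D)" using assms(4) D(2) by simp
qed

text \<open>Reversal exchanges \<open>tl\<close> and \<open>butlast\<close> and would turn the
  inequality around; the complement \<open>c - \<chi>\<close> turns it back. The bound by
  \<open>c\<close> makes the truncated subtraction reversible.\<close>

lemma decreasing_run:
  assumes "shift_antimono (Suc j) (\<lambda>us. F (deltas us)) vs"
    and "sorted_wrt (<) vs" "sorted_wrt (>) (deltas vs)"
    and "\<And>D. sorted_wrt (>) D \<Longrightarrow> length D = j \<Longrightarrow> F D = c - \<chi> (rev D)"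
    and "\<And>D. \<chi> D \<le> c"
  shows "shift_antimono j \<chi> (rev (deltas vs))"
  unfolding shift_antimono_def
proof (intro allI impI)
  fix D' assume D': "subseq D' (rev (deltas vs))" "length D' = Suc j"
  define D where "D = rev D'"
  then have D: "subseq D (deltas vs)" "length D = Suc j"
    using D' subseq_rev by fastforce+
  then have "vs \<noteq> []" by auto
  then obtain us where us: "subseq us vs" "us \<noteq> []" "deltas us = D"
    using select_decreasing[OF _ assms(2,3) D(1)] by auto
  have sD: "sorted_wrt (>) D" using assms(3) D(1) sorted_wrt_subseq by blast
  have "length us = Suc (Suc j)" using us D(2) by (cases us) auto
  then have "F (tl D) \<le> F (butlast D)"
    using assms(1) us unfolding shift_antimono_def by (metis deltas_tl deltas_butlast)
  moreover have "sorted_wrt (>) (tl D)" "sorted_wrt (>) (butlast D)"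
    using sD sorted_wrt_subseq subseq_tl subseq_butlast by blast+
  ultimately have "c - \<chi> (rev (tl D)) \<le> c - \<chi> (rev (butlast D))" using assms(4) D(2) by simp
  moreover have "rev (tl D) = butlast D'" "rev (butlast D) = tl D'"
    unfolding D_def by (metis butlast_rev rev_rev_ident, metis butlast_rev rev_rev_ident)
  ultimately show "\<chi> (tl D') \<le> \<chi> (butlast D')"
    using assms(5)[of "tl D'"] assms(5)[of "butlast D'"] by simp
qed

lemma shift_antimono_windows:
  assumes "shift_antimono (Suc j) (\<lambda>us. F (deltas us)) vs"
    and "i \<le> i'" "i' + j \<le> length (deltas vs)" "1 \<le> j"
  shows "F (take j (drop i' (deltas vs))) \<le> F (take j (drop i (deltas vs)))"
  using windows_antimono[OF assms(1,2)] assms(3,4) by (simp add: deltas_window)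

lemma monotone_list_iff_signs:
  "monotone_list D \<longleftrightarrow> (\<forall>i. Suc i < length D \<longrightarrow> D ! i < D ! Suc i) \<or> (\<forall>i. Suc i < length D \<longrightarrow> D ! i > D ! Suc i)"
  unfolding monotone_list_def by (simp add: sorted_wrt_iff_nth_Suc_transp)

lemma monotone_window:
  assumes "sorted_wrt (<) vs" "a + n \<le> length (deltas vs)"
    and "\<And>t. a \<le> t \<Longrightarrow> Suc (Suc t) < a + n \<Longrightarrow>
      deltas vs ! t < deltas vs ! Suc t \<longleftrightarrow> deltas vs ! Suc t < deltas vs ! Suc (Suc t)"
  shows "monotone_list (take n (drop a (deltas vs)))"
proof -
  let ?D = "deltas vs"
  have const: "?D ! (a + t) < ?D ! Suc (a + t) \<longleftrightarrow> ?D ! a < ?D ! Suc a" if "Suc t < n" for t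
    using that
  proof (induction t)
    case (Suc t)
    then show ?case using assms(3)[of "a + t"] by simp
  qed simp
  have neq: "?D ! (a + t) \<noteq> ?D ! Suc (a + t)" if "Suc t < n" for t
    using deltas_neq[OF assms(1)] assms(2) that by simp
  show ?thesis
  proof (cases "?D ! a < ?D ! Suc a")
    case True
    then show ?thesis using const assms(2) by (auto simp: monotone_list_iff_signs)
  next
    case False
    then have "?D ! Suc (a + t) < ?D ! (a + t)" if "Suc t < n" for t
      using const[OF that] neq[OF that] by linarith
    then show ?thesis using assms(2) by (auto simp: monotone_list_iff_signs)
  qed
qed

section \<open>Lifted colourings and the crude step\<close>

definition lift_colour :: "nat \<Rightarrow> (nat list \<Rightarrow> nat) \<Rightarrow> (nat list \<Rightarrow> nat) \<Rightarrow> nat list \<Rightarrow> nat" where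
  "lift_colour q \<chi> g D =
     (if sorted_wrt (<) D then \<chi> D else if sorted_wrt (>) D then q - 1 - \<chi> (rev D) else g D)"

lemma lift_colour_less:
  assumes "\<And>us. \<chi> us < q" "\<And>D. g D < q"
  shows "lift_colour q \<chi> g D < q"
  using assms(1)[of D] assms(2)[of D] by (auto simp: lift_colour_def)

lemma lift_colour_decreasing:
  "sorted_wrt (>) D \<Longrightarrow> 2 \<le> length D \<Longrightarrow> lift_colour q \<chi> g D = q - 1 - \<chi> (rev D)"
  by (cases D; cases "tl D") (auto simp: lift_colour_def)

text \<open>A monotone run of \<open>n\<close> deltas is, up to reversal, an antimonotone
  \<open>n\<close>-set of the lower colouring. The constant \<open>c\<close> is kept general because
  the four-colour base complements a two-valued \<open>\<chi>\<close> with respect to 3.\<close>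

lemma no_long_run:
  assumes \<chi>: "\<And>us. \<chi> us \<le> c"
    "\<And>vs. sorted_wrt (<) vs \<Longrightarrow> set vs \<subseteq> {..<N} \<Longrightarrow> length vs = n \<Longrightarrow> \<not> shift_antimono j \<chi> vs"
    and vs: "sorted_wrt (<) vs" "set vs \<subseteq> {..<2 ^ N}" "shift_antimono (Suc j) (\<lambda>us. F (deltas us)) vs"
    and F: "\<And>D. sorted_wrt (<) D \<Longrightarrow> length D = j \<Longrightarrow> F D = \<chi> D"
      "\<And>D. sorted_wrt (>) D \<Longrightarrow> length D = j \<Longrightarrow> F D = c - \<chi> (rev D)"
    and mono: "a + n \<le> length (deltas vs)" "n \<ge> 1"
      "monotone_list (take n (drop a (deltas vs)))"
  shows False
proof -
  define us where "us = take (Suc n) (drop a vs)"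
  have D: "deltas us = take n (drop a (deltas vs))" by (simp add: us_def deltas_window)
  have sub: "subseq us vs" unfolding us_def by (rule subseq_window)
  have us: "sorted_wrt (<) us" "set us \<subseteq> {..<2 ^ N}" "shift_antimono (Suc j) (\<lambda>us. F (deltas us)) us"
    using sub vs set_subseq[OF sub] sorted_wrt_subseq shift_antimono_subseq by blast+
  have "length (deltas us) = n" using mono(1) by (simp add: D)
  moreover have "set (deltas us) \<subseteq> {..<N}" using set_deltas us by blast
  ultimately show False
    using \<chi>(2)[of "deltas us"] \<chi>(2)[of "rev (deltas us)"] mono(3)
      increasing_run[where \<chi> = \<chi>, OF us(3,1) _ F(1)] decreasing_run[where \<chi> = \<chi>, OF us(3,1) _ F(2) \<chi>(1)]
    by (auto simp: D[symmetric] monotone_list_def sorted_wrt_rev)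
qed

lemma sign_change:
  fixes P :: "nat \<Rightarrow> bool"
  assumes "P a \<noteq> P b" "a \<le> b"
  shows "\<exists>t. a \<le> t \<and> t < b \<and> P t = P a \<and> P (Suc t) \<noteq> P a"
  using assms(2,1)
proof (induction b rule: dec_induct)
  case (step b)
  then show ?case by (cases "P b = P a") (auto intro: less_SucI)
qed simp

text \<open>A window starting with a peak gets colour 0, one starting with a valley gets
  \<open>q - 1\<close>, so no valley can follow a peak. Each of three consecutive blocks of
  \<open>n\<close> deltas contains a turn, and since peaks and valleys alternate, three turns
  enforce a peak followed by a valley. The summand \<open>j\<close> leaves room for a full window at
  each of them.\<close>

lemma avoidable_step_lossy:
  assumes "avoidable q j n N" "3 \<le> j" "2 \<le> q" "1 \<le> n"
  shows "avoidable q (Suc j) (3 * n + j) (2 ^ N)"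
proof -
  obtain \<chi> where \<chi>: "\<And>us. \<chi> us < q"
    "\<And>vs. sorted_wrt (<) vs \<Longrightarrow> set vs \<subseteq> {..<N} \<Longrightarrow> length vs = n \<Longrightarrow> \<not> shift_antimono j \<chi> vs"
    using assms(1) unfolding avoidable_def by blast
  define F where "F = lift_colour q \<chi> (\<lambda>D. if D ! 0 < D ! 1 then 0 else q - 1)"
  have F1: "\<And>D. sorted_wrt (<) D \<Longrightarrow> length D = j \<Longrightarrow> F D = \<chi> D"
    by (simp add: F_def lift_colour_def)
  have F2: "\<And>D. sorted_wrt (>) D \<Longrightarrow> length D = j \<Longrightarrow> F D = (q - 1) - \<chi> (rev D)"
    using assms(2) by (simp add: F_def lift_colour_decreasing)
  have \<chi>le: "\<chi> us \<le> q - 1" for us using \<chi>(1)[of us] by simp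
  have Fq: "F D < q" for D
    unfolding F_def using \<chi>(1) assms(3) by (intro lift_colour_less) auto
  have "\<not> shift_antimono (Suc j) (\<lambda>us. F (deltas us)) vs"
    if vs: "sorted_wrt (<) vs" "set vs \<subseteq> {..<2 ^ N}" "length vs = 3 * n + j" for vs
  proof
    assume anti: "shift_antimono (Suc j) (\<lambda>us. F (deltas us)) vs"
    define D where "D = deltas vs"
    define P where "P i \<longleftrightarrow> D ! i < D ! Suc i" for i
    have lD: "length D = 3 * n + j - 1" by (simp add: D_def vs)
    have neq: "D ! i \<noteq> D ! Suc i" if "Suc i < length D" for i
      using deltas_neq[OF vs(1)] that by (simp add: D_def)
    have win: "F (take j (drop i D)) = (if P i then 0 else q - 1)"
      if "P i \<noteq> P (Suc i)" "i + j \<le> length D" for i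
    proof -
      let ?W = "take j (drop i D)"
      have W: "?W ! 0 = D ! i" "?W ! 1 = D ! Suc i" "?W ! 2 = D ! Suc (Suc i)" "length ?W = j"
        using that assms(2) by (auto simp: numeral_2_eq_2)
      have "\<not> sorted_wrt (<) ?W"
        using that(1) W assms(2) sorted_wrt_nth_less[of "(<)" ?W 0 1] sorted_wrt_nth_less[of "(<)" ?W 1 2]
        by (auto simp: P_def)
      moreover have "\<not> sorted_wrt (>) ?W"
        using that(1) W assms(2) sorted_wrt_nth_less[of "(>)" ?W 0 1] sorted_wrt_nth_less[of "(>)" ?W 1 2]
        by (auto simp: P_def)
      ultimately show ?thesis using W by (simp add: F_def lift_colour_def P_def)
    qed
    have peak_valley: False
      if "P i" "\<not> P (Suc i)" "i < i'" "\<not> P i'" "P (Suc i')" "i' + j \<le> length D" for i i'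
    proof -
      have "F (take j (drop i' D)) \<le> F (take j (drop i D))"
        unfolding D_def by (rule shift_antimono_windows[OF anti]) (use that assms in \<open>auto simp: D_def\<close>)
      then show False using win[of i] win[of i'] that assms(3) by simp
    qed
    have turn: "\<exists>t\<ge>a. Suc (Suc t) < a + n \<and> P t \<noteq> P (Suc t)" if "a \<le> 2 * n" for a
    proof (rule ccontr)
      assume "\<not> ?thesis"
      then have *: "P t = P (Suc t)" if "a \<le> t" "Suc (Suc t) < a + n" for t
        using that by blast
      have "a + n \<le> length (deltas vs)" using that lD assms by (simp add: D_def)
      moreover from this have "monotone_list (take n (drop a (deltas vs)))"
        by (rule monotone_window[OF vs(1)]) (use * in \<open>simp add: P_def D_def\<close>)
      ultimately show False
        using assms(4) by (intro no_long_run[OF \<chi>le \<chi>(2) vs(1,2) anti F1 F2])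
    qed
    obtain t1 where t1: "Suc (Suc t1) < n" "P t1 \<noteq> P (Suc t1)"
      using turn[of 0] by auto
    obtain t2 where t2: "n \<le> t2" "Suc (Suc t2) < 2 * n" "P t2 \<noteq> P (Suc t2)"
      using turn[of n] by (auto simp: mult_2)
    obtain t3 where t3: "2 * n \<le> t3" "Suc (Suc t3) < 3 * n" "P t3 \<noteq> P (Suc t3)"
      using turn[of "2 * n"] by auto
    note t = t1 t2 t3
    have peak: False if h: "P t'" "\<not> P (Suc t')" "Suc t' < t3" for t'
    proof (cases "P t3")
      case True
      then obtain s where "Suc t' \<le> s" "s < t3" "\<not> P s" "P (Suc s)"
        using sign_change[of P "Suc t'" t3] h by auto
      moreover from this have "s + j \<le> length D" using lD t(7) by linarith
      ultimately show False using peak_valley[of t' s] h by simp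
    next
      case False
      moreover have "t3 + j \<le> length D" using lD t(7) by linarith
      ultimately show False using peak_valley[of t' t3] h t(8) by simp
    qed
    show False
    proof (cases "P t1 \<or> P t2")
      case True
      then show False using peak[of t1] peak[of t2] t by auto
    next
      case False
      then obtain s where "Suc t1 \<le> s" "s < t2" "P s" "\<not> P (Suc s)"
        using sign_change[of P "Suc t1" t2] t by auto
      moreover have "t2 + j \<le> length D" using lD t(4) by linarith
      ultimately show False using peak_valley[of s t2] False t(5) by simp
    qed
  qed
  then show ?thesis
    unfolding avoidable_def using Fq by (intro exI[of _ "\<lambda>us. F (deltas us)"]) simp
qed

section \<open>Stepping up with an additive loss\<close>

definition up :: "nat list \<Rightarrow> nat \<Rightarrow> bool" where
  "up D i \<longleftrightarrow> D ! i < D ! Suc i"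

lemma up_Cons_0: "xs \<noteq> [] \<Longrightarrow> up (x # xs) 0 \<longleftrightarrow> x < hd xs"
  by (simp add: up_def hd_conv_nth)

lemma up_Cons_Suc [simp]: "up (x # xs) (Suc i) = up xs i"
  by (simp add: up_def)

lemma up_take [simp]: "Suc i < m \<Longrightarrow> up (take m xs) i = up xs i"
  by (simp add: up_def)

lemma up_drop [simp]: "Suc (m + i) < length xs \<Longrightarrow> up (drop m xs) i = up xs (m + i)"
  by (simp add: up_def)

lemma up_tl [simp]: "Suc (Suc i) < length xs \<Longrightarrow> up (tl xs) i = up xs (Suc i)"
  by (simp add: up_def nth_tl)

lemma up_append: "Suc i < length xs \<Longrightarrow> up (xs @ ys) i = up xs i"
  by (simp add: up_def nth_append)

lemma up_append_last: "xs \<noteq> [] \<Longrightarrow> Suc i = length xs \<Longrightarrow> up (xs @ y # ys) i \<longleftrightarrow> last xs < y"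
  by (metis diff_Suc_1 last_conv_nth lessI nth_append nth_append_length up_def)

lemma up_increasing: "sorted_wrt (<) D \<Longrightarrow> Suc i < length D \<Longrightarrow> up D i"
  by (simp add: up_def sorted_wrt_nth_less)

lemma not_up_decreasing: "sorted_wrt (>) D \<Longrightarrow> Suc i < length D \<Longrightarrow> \<not> up D i"
  using sorted_wrt_nth_less[of "(>)" D i "Suc i"] by (simp add: up_def)

lemma up_subseq_monotone:
  assumes "monotone_list X" "subseq Y X" "Suc i < length Y" "Suc k < length X"
  shows "up Y i = up X k"
  using assms up_increasing not_up_decreasing sorted_wrt_subseq[OF _ assms(2)]
  unfolding monotone_list_def by metis

lemma monotone_window_up:
  assumes "sorted_wrt (<) vs" "a + m \<le> length (deltas vs)"
    and "\<And>t. a < t \<Longrightarrow> Suc t < a + m \<Longrightarrow> up (deltas vs) t = up (deltas vs) a"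
  shows "monotone_list (take m (drop a (deltas vs)))"
proof (rule monotone_window[OF assms(1,2)])
  fix t assume "a \<le> t" "Suc (Suc t) < a + m"
  then have "up (deltas vs) t = up (deltas vs) (Suc t)"
    using assms(3)[of t] assms(3)[of "Suc t"] by (cases "t = a") auto
  then show "deltas vs ! t < deltas vs ! Suc t \<longleftrightarrow> deltas vs ! Suc t < deltas vs ! Suc (Suc t)"
    by (simp add: up_def)
qed

definition head_turn :: "nat list \<Rightarrow> bool" where
  "head_turn D \<longleftrightarrow> up D 0 \<noteq> up D 1 \<and> (\<forall>i. 1 < i \<longrightarrow> Suc i < length D \<longrightarrow> up D i = up D 1)"

definition tail_turn :: "nat list \<Rightarrow> bool" where
  "tail_turn D \<longleftrightarrow> (\<forall>i. 0 < i \<longrightarrow> Suc (Suc i) < length D \<longrightarrow> up D i = up D 0) \<and> up D (length D - 2) \<noteq> up D 0"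

text \<open>In sign patterns: \<open>aab\<close> followed by anything, or \<open>abaa...a\<close>.
  The second form is included so that a turn at the second place followed by constant signs counts
  as early whatever the first sign is.\<close>

definition early_turn :: "nat list \<Rightarrow> bool" where
  "early_turn D \<longleftrightarrow> up D 1 \<noteq> up D 2 \<and>
     (up D 0 = up D 1 \<or> (\<forall>i. 2 < i \<longrightarrow> Suc i < length D \<longrightarrow> up D i = up D 2))"

text \<open>\<open>G\<close> marks the monotone runs for which the default colour of a single turn at the end is swapped;
  it is empty in the first of two steps.\<close>

definition turn_colour :: "nat \<Rightarrow> nat list set \<Rightarrow> nat list \<Rightarrow> nat" where
  "turn_colour q G D =
     (if head_turn D then if tl D \<in> G then 0 else q - 1
      else if tail_turn D then if rev (butlast D) \<in> G then q - 1 else 0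
      else if early_turn D then 0 else q - 1)"

text \<open>The bound on \<open>n\<close> gives lists of \<open>n + 2\<close> vertices the
  \<open>2 * j + 4\<close> deltas that \<open>blue_signs\<close> asks for. The assumption
  \<open>avoid\<close> lets a run of \<open>j\<close> deltas be thinned by one entry, with its head
  kept, to a run whose turns have the default colour.\<close>

locale tight_step =
  fixes q j n N :: nat and \<chi> :: "nat list \<Rightarrow> nat" and G :: "nat list set"
  assumes q: "2 \<le> q" and j: "6 \<le> j" and n: "2 * j + 3 \<le> n"
    and \<chi>_less: "\<And>us. \<chi> us < q"
    and \<chi>: "\<And>vs. sorted_wrt (<) vs \<Longrightarrow> set vs \<subseteq> {..<N} \<Longrightarrow> length vs = n \<Longrightarrow> \<not> shift_antimono j \<chi> vs"
    and avoid: "\<And>X. monotone_list X \<Longrightarrow> length X = j \<Longrightarrow>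
      \<exists>Y. subseq Y X \<and> length Y = j - 1 \<and> hd Y = hd X \<and> Y \<notin> G"
begin

definition F :: "nat list \<Rightarrow> nat" where
  "F = lift_colour q \<chi> (turn_colour q G)"

abbreviation blue :: "nat list \<Rightarrow> bool" where
  "blue vs \<equiv> sorted_wrt (<) vs \<and> shift_antimono (Suc j) (\<lambda>us. F (deltas us)) vs"

lemma F_less: "F D < q"
  unfolding F_def using \<chi>_less q by (intro lift_colour_less) (auto simp: turn_colour_def)

lemma F_increasing: "sorted_wrt (<) D \<Longrightarrow> F D = \<chi> D"
  by (simp add: F_def lift_colour_def)

lemma F_decreasing: "sorted_wrt (>) D \<Longrightarrow> 2 \<le> length D \<Longrightarrow> F D = q - 1 - \<chi> (rev D)"
  by (simp add: F_def lift_colour_decreasing)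

lemma F_turn:
  assumes "up D a \<noteq> up D b" "Suc a < length D" "Suc b < length D"
  shows "F D = turn_colour q G D"
proof -
  have "\<not> sorted_wrt (<) D" "\<not> sorted_wrt (>) D"
    using assms up_increasing not_up_decreasing by blast+
  then show ?thesis by (simp add: F_def lift_colour_def)
qed

lemma F_head: "length D = j \<Longrightarrow> head_turn D \<Longrightarrow> F D = (if tl D \<in> G then 0 else q - 1)"
  using F_turn[of D 0 1] j by (simp add: head_turn_def turn_colour_def)

lemma F_tail:
  assumes "length D = j" "tail_turn D"
  shows "F D = (if rev (butlast D) \<in> G then q - 1 else 0)"
proof -
  have "up D 1 = up D 0" using assms j by (simp add: tail_turn_def)
  then have "\<not> head_turn D" by (simp add: head_turn_def)
  then show ?thesis
    using F_turn[of D 0 "j - 2"] j assms by (simp add: tail_turn_def turn_colour_def)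
qed

lemma F_early:
  assumes "length D = j" "early_turn D"
  shows "F D = 0"
proof -
  have *: "up D 1 \<noteq> up D 2" using assms(2) by (simp add: early_turn_def)
  have "\<not> head_turn D"
  proof
    assume "head_turn D"
    then have "up D 2 = up D 1" using assms(1) j by (simp add: head_turn_def)
    then show False using * by simp
  qed
  moreover have "\<not> tail_turn D"
  proof
    assume "tail_turn D"
    then have "up D 1 = up D 0" "up D 2 = up D 0" using assms(1) j by (simp_all add: tail_turn_def)
    then show False using * by simp
  qed
  ultimately show ?thesis
    using F_turn[OF *] assms j by (simp add: turn_colour_def)
qed

lemma F_late:
  assumes "length D = j" "\<And>t. 0 < t \<Longrightarrow> t < j - 3 \<Longrightarrow> up D t = up D 0" "up D (j - 3) \<noteq> up D 0"
  shows "F D = q - 1"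
proof -
  \<comment> \<open>Here \<open>6 \<le> j\<close> is essential: both places lie before the turn at
    \<open>j - 3\<close>, which separates late turns from early ones.\<close>
  have *: "up D 1 = up D 0" "up D 2 = up D 0" using assms(2) j by simp_all
  then have "\<not> head_turn D" "\<not> early_turn D" by (simp_all add: head_turn_def early_turn_def)
  moreover have "\<not> tail_turn D"
  proof
    assume "tail_turn D"
    then have "up D (j - 3) = up D 0" using assms(1) j by (simp add: tail_turn_def)
    then show False using assms(3) by simp
  qed
  ultimately show ?thesis
    using F_turn[of D "j - 3" 0] assms j by (simp add: turn_colour_def)
qed

lemma F_zero_turn:
  assumes "length D = j" "up D 0 \<noteq> up D 1" "F D = 0" "\<not> head_turn D"
  shows "early_turn D"
proof -
  have "\<not> tail_turn D"
  proof
    assume "tail_turn D"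
    then have "up D 1 = up D 0" using assms(1) j by (simp add: tail_turn_def)
    then show False using assms(2) by simp
  qed
  moreover have "F D = turn_colour q G D" using F_turn[OF assms(2)] assms(1) j by simp
  ultimately show ?thesis using assms(3,4) q by (auto simp: turn_colour_def split: if_splits)
qed

section \<open>Sign sequences of blue lists\<close>

text \<open>With the run thinned to \<open>Y\<close>, the list \<open>D ! i # Y\<close> is a head
  turn of colour \<open>q - 1\<close>, whereas \<open>D ! (i - 1) # D ! i # butlast Y\<close> is an
  early turn of colour 0. These are the \<open>tl\<close> and the \<open>butlast\<close> of one
  delta list, against blueness. \<open>Y\<close> keeps the head of the run so that the turn and the
  vertex where it is attached survive.\<close>

lemma run_start_False:
  assumes "blue vs" and D: "D = deltas vs"
    and i: "1 \<le> i" "Suc i + j \<le> length D" "up D i \<noteq> up D (Suc i)"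
    and run: "\<And>t. Suc i < t \<Longrightarrow> t < i + j \<Longrightarrow> up D t = up D (Suc i)"
  shows False
proof -
  define X where "X = take j (drop (Suc i) D)"
  define ws where "ws = take (Suc j) (drop (Suc i) vs)"
  have vs: "sorted_wrt (<) vs" "shift_antimono (Suc j) (\<lambda>us. F (deltas us)) vs"
    using assms(1) by blast+
  have lvs: "Suc i + j < length vs" using i D by simp
  have X: "monotone_list X" "length X = j" "hd X = D ! Suc i" "up X 0 = up D (Suc i)" "deltas ws = X"
  proof -
    show "monotone_list X"
      unfolding X_def D using run i D by (intro monotone_window_up[OF vs(1)]) auto
  qed (use i j in \<open>simp_all add: X_def ws_def D deltas_window hd_drop_conv_nth\<close>)
  obtain Y where Y: "subseq Y X" "length Y = j - 1" "hd Y = hd X" "Y \<notin> G"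
    using avoid X by blast
  have upY: "up Y t = up D (Suc i)" if "Suc t < j - 1" for t
    using up_subseq_monotone[OF X(1) Y(1), of t 0] that X Y(2) j by simp
  have ws: "ws \<noteq> []" "sorted_wrt (<) ws" "hd ws = vs ! Suc i"
    using i lvs sorted_wrt_subseq[OF vs(1)] subseq_window
    by (auto simp: ws_def hd_drop_conv_nth)
  have Yne: "Y \<noteq> []" using Y(2) j by auto
  obtain us where us: "subseq us ws" "us \<noteq> []" "deltas us = Y" "hd us = vs ! Suc i"
    using select_monotone[OF ws(1,2), of Y] X(1,5) Y(1,3) ws(3) Yne by metis
  define us' where "us' = vs ! (i - 1) # vs ! i # us"
  have "vs = take (i - 1) vs @ vs ! (i - 1) # vs ! i # drop (Suc i) vs"
  proof -
    have "drop (i - 1) vs = vs ! (i - 1) # drop i vs"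
      using Cons_nth_drop_Suc[of "i - 1" vs] i lvs by simp
    also have "drop i vs = vs ! i # drop (Suc i) vs"
      using Cons_nth_drop_Suc[of i vs] lvs by simp
    finally show ?thesis by (metis append_take_drop_id)
  qed
  moreover have "subseq us (drop (Suc i) vs)"
    using us(1) subseq_order.order_trans prefix_imp_subseq take_is_prefix unfolding ws_def by blast
  ultimately have sub: "subseq us' vs"
    unfolding us'_def by (metis subseq_Cons2 subseq_drop_many)
  have Dus': "deltas us' = D ! (i - 1) # D ! i # Y"
  proof -
    obtain u us1 where u: "us = u # us1" using us(2) by (cases us) auto
    have "delta (vs ! (i - 1)) (vs ! i) = D ! (i - 1)" "delta (vs ! i) (vs ! Suc i) = D ! i"
      using i lvs nth_deltas[of "i - 1" vs] nth_deltas[of i vs] by (simp_all add: D)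
    then show ?thesis using us u by (simp add: us'_def)
  qed
  have len: "length us' = Suc (Suc j)"
  proof -
    have "length us = Suc (length Y)" using us(2,3) by (cases us) auto
    then show ?thesis using Y(2) j by (simp add: us'_def)
  qed
  have "F (deltas (tl us')) \<le> F (deltas (butlast us'))"
    using vs(2) sub len unfolding shift_antimono_def by blast
  moreover have "deltas (tl us') = D ! i # Y" using Dus' by (simp add: deltas_tl)
  moreover have "deltas (butlast us') = D ! (i - 1) # D ! i # butlast Y"
    using Dus' Yne by (simp add: deltas_butlast)
  moreover have "F (D ! i # Y) = q - 1"
  proof -
    have "up (D ! i # Y) 0 = up D i" using Y(3) X(3) Yne by (simp add: up_Cons_0) (simp add: up_def)
    moreover have "up (D ! i # Y) t = up D (Suc i)" if "0 < t" "Suc t < j" for t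
      using upY[of "t - 1"] that by (cases t) auto
    ultimately have "head_turn (D ! i # Y)" using upY[of 0] i(3) j Y(2) by (simp add: head_turn_def)
    then show ?thesis using F_head Y(2,4) j by simp
  qed
  moreover have "F (D ! (i - 1) # D ! i # butlast Y) = 0"
  proof (rule F_early)
    let ?Z = "D ! (i - 1) # D ! i # butlast Y"
    show "length ?Z = j" using Y(2) j by simp
    have bne: "butlast Y \<noteq> []" "hd (butlast Y) = hd Y"
      using Y(2) j by (cases Y; cases "tl Y"; force)+
    have "up ?Z 1 = up D i" using bne Y(3) X(3) up_Cons_0[of "butlast Y"]
      by (simp add: up_def)
    moreover have "up ?Z t = up D (Suc i)" if "2 \<le> t" "Suc t < j" for t
    proof -
      define s where "s = t - 2"
      have s: "t = Suc (Suc s)" using that by (simp add: s_def)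
      have "up (butlast Y) s = up Y s" using that s Y(2) by (simp add: up_def nth_butlast)
      then show ?thesis using upY[of s] that s Y(2) by simp
    qed
    ultimately show "early_turn ?Z" using i(3) Y(2) j by (simp add: early_turn_def)
  qed
  ultimately show False using q by simp
qed

text \<open>At the end of a run the conflicting lists are \<open>Y @ [d]\<close>, a tail turn of
  colour 0, and \<open>tl Y @ [d, e]\<close>, where the turn has moved one place inwards and the
  colour is \<open>q - 1\<close>. The bound on \<open>a + j\<close> guarantees the entry
  \<open>e\<close> behind the turn.\<close>

lemma run_end_False:
  assumes "blue vs" and D: "D = deltas vs"
    and a: "Suc (a + j) < length D" "up D (a + j - 1) \<noteq> up D a"
    and run: "\<And>t. a < t \<Longrightarrow> Suc t < a + j \<Longrightarrow> up D t = up D a"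
  shows False
proof -
  define X where "X = take j (drop a D)"
  define ws where "ws = take (Suc j) (drop a vs)"
  have vs: "sorted_wrt (<) vs" "shift_antimono (Suc j) (\<lambda>us. F (deltas us)) vs"
    using assms(1) by blast+
  have lvs: "Suc (Suc (a + j)) < length vs" using a D by simp
  have X: "monotone_list X" "length X = j" "last X = D ! (a + j - 1)" "up X 0 = up D a" "deltas ws = X"
  proof -
    show "monotone_list X"
      unfolding X_def D using run a D by (intro monotone_window_up[OF vs(1)]) auto
    have "X \<noteq> []" using a j by (auto simp: X_def)
    then show "last X = D ! (a + j - 1)" using a j by (simp add: last_conv_nth X_def)
  qed (use a j in \<open>simp_all add: X_def ws_def D deltas_window\<close>)
  \<comment> \<open>Runs are compared with \<open>G\<close> starting from their turn, which is now
    at the last entry; hence \<open>avoid\<close> is applied to the reversed run.\<close>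
  have "monotone_list (rev X)" using X(1) by (auto simp: monotone_list_def sorted_wrt_rev)
  then obtain Y0 where Y0: "subseq Y0 (rev X)" "length Y0 = j - 1" "hd Y0 = hd (rev X)" "Y0 \<notin> G"
    using avoid X(2) by (metis length_rev)
  define Y where "Y = rev Y0"
  have Yne: "Y \<noteq> []" using Y0(2) j by (auto simp: Y_def)
  have Y: "subseq Y X" "length Y = j - 1" "last Y = last X" "rev Y \<notin> G"
    using Y0 subseq_rev[OF Y0(1)] by (simp_all add: Y_def last_rev hd_rev)
  have upY: "up Y t = up D a" if "Suc t < j - 1" for t
    using up_subseq_monotone[OF X(1) Y(1), of t 0] that X Y(2) j by simp
  have ws: "ws \<noteq> []" "sorted_wrt (<) ws" "last ws = vs ! (a + j)"
    using a lvs sorted_wrt_subseq[OF vs(1)] subseq_window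
    by (auto simp: ws_def last_conv_nth)
  obtain us where us: "subseq us ws" "us \<noteq> []" "deltas us = Y" "last us = vs ! (a + j)"
    using select_monotone[OF ws(1,2), of Y] X(1,5) Y(1,3) ws(3) Yne by metis
  define d e where "d = D ! (a + j)" and "e = D ! Suc (a + j)"
  define us' where "us' = us @ [vs ! Suc (a + j), vs ! Suc (Suc (a + j))]"
  have "vs = take (Suc (a + j)) vs @ vs ! Suc (a + j) # vs ! Suc (Suc (a + j)) # drop (Suc (Suc (Suc (a + j)))) vs"
    using a lvs by (simp add: Cons_nth_drop_Suc)
  moreover have "subseq us (take (Suc (a + j)) vs)"
  proof -
    have "ws = drop a (take (Suc (a + j)) vs)" unfolding ws_def by (simp add: take_drop add.commute)
    then show ?thesis
      using us(1) subseq_order.order_trans suffix_imp_subseq suffix_drop by metis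
  qed
  ultimately have sub: "subseq us' vs"
    unfolding us'_def by (metis list_emb_append_mono subseq_Cons2 list_emb_Nil)
  have Dus': "deltas us' = Y @ [d, e]"
  proof -
    obtain us1 u where u: "us = us1 @ [u]" using us(2) by (cases us rule: rev_cases) auto
    have "us' = (us1 @ [u, vs ! Suc (a + j)]) @ [vs ! Suc (Suc (a + j))]" by (simp add: us'_def u)
    then have "deltas us' = deltas (us1 @ [u, vs ! Suc (a + j)]) @ [delta (vs ! Suc (a + j)) (vs ! Suc (Suc (a + j)))]"
      using deltas_snoc[of "us1 @ [u]"] by simp
    also have "\<dots> = deltas us @ [delta u (vs ! Suc (a + j)), delta (vs ! Suc (a + j)) (vs ! Suc (Suc (a + j)))]"
      by (simp add: deltas_snoc u)
    finally show ?thesis using us(3,4) u lvs by (simp add: d_def e_def D nth_deltas)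
  qed
  have len: "length us' = Suc (Suc j)"
  proof -
    have "length us = Suc (length Y)" using us(2,3) by (cases us) auto
    then show ?thesis using Y(2) j by (simp add: us'_def)
  qed
  have "F (deltas (tl us')) \<le> F (deltas (butlast us'))"
    using vs(2) sub len unfolding shift_antimono_def by blast
  moreover have "deltas (tl us') = tl Y @ [d, e]" using Dus' Yne by (simp add: deltas_tl)
  moreover have "deltas (butlast us') = Y @ [d]"
    using Dus' by (simp add: deltas_butlast butlast_append)
  moreover have turn: "(last Y < d) = up D (a + j - 1)"
    using Y(3) X(3) j by (simp add: up_def d_def)
  have "F (Y @ [d]) = 0"
  proof -
    have "up (Y @ [d]) (j - 2) = up D (a + j - 1)"
      using up_append_last[OF Yne, of "j - 2" d] turn Y(2) j by simp
    moreover have "up (Y @ [d]) t = up D a" if "Suc (Suc t) < j" for t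
      using up_append[of t Y] upY[of t] that Y(2) by simp
    ultimately have "tail_turn (Y @ [d])" using a(2) Y(2) j by (simp add: tail_turn_def)
    then show ?thesis using F_tail Y(2,4) j by simp
  qed
  moreover have "F (tl Y @ [d, e]) = q - 1"
  proof (rule F_late)
    let ?Z = "tl Y @ [d, e]"
    show "length ?Z = j" using Y(2) j by simp
    have tne: "tl Y \<noteq> []" "last (tl Y) = last Y" "length (tl Y) = j - 2"
      using Y(2) j by (cases Y; force)+
    have *: "up ?Z t = up D a" if "t < j - 3" for t
    proof -
      have "up ?Z t = up (tl Y) t" using that tne by (intro up_append) simp
      also have "\<dots> = up Y (Suc t)" using that tne by (simp add: up_def nth_tl)
      finally show ?thesis using upY[of "Suc t"] that by simp
    qed
    then show "up ?Z t = up ?Z 0" if "t < j - 3" for t using that j by simp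
    show "up ?Z (j - 3) \<noteq> up ?Z 0"
      using up_append_last[OF tne(1), of "j - 3" d] tne *[of 0] turn a(2) j by simp
  qed
  ultimately show False using q by simp
qed

text \<open>The sign of the run spreads: the nearest deviation on the left would be a forbidden
  start, the nearest on the right a forbidden end. The first and the last sign escape because both
  arguments need one more delta beyond the turn.\<close>

lemma long_run:
  assumes "blue vs" and D: "D = deltas vs"
    and a: "a + j \<le> length D"
    and run: "\<And>t. a < t \<Longrightarrow> Suc t < a + j \<Longrightarrow> up D t = up D a"
    and t: "1 \<le> t" "Suc (Suc t) < length D"
  shows "up D t = up D 1"
proof -
  have left: "up D t = up D a" if ta: "1 \<le> t" "t \<le> a" for t
  proof (rule ccontr)
    assume ne: "up D t \<noteq> up D a"
    obtain s where s: "t \<le> s" "s < a" "up D s \<noteq> up D a" "\<And>u. s < u \<Longrightarrow> u \<le> a \<Longrightarrow> up D u = up D a"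
    proof -
      define S where "S = {s. t \<le> s \<and> s \<le> a \<and> up D s \<noteq> up D a}"
      have S: "finite S" "S \<noteq> {}" using ta ne by (auto simp: S_def)
      then have M: "Max S \<in> S" by (rule Max_in)
      show ?thesis
      proof (rule that[of "Max S"])
        show "up D u = up D a" if u: "Max S < u" "u \<le> a" for u
        proof (rule ccontr)
          assume "up D u \<noteq> up D a"
          then have "u \<in> S" using u M by (auto simp: S_def)
          then show False using Max_ge[OF S(1)] u by fastforce
        qed
      qed (use M in \<open>auto simp: S_def order_less_le\<close>)
    qed
    have up': "up D u = up D a" if "Suc s \<le> u" "Suc u < a + j" for u
      using run[of u] s(4)[of u] that by (cases "u \<le> a") auto
    show False
    proof (rule run_start_False[OF assms(1) D, of s])
      show "up D u = up D (Suc s)" if "Suc s < u" "u < s + j" for u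
        using up'[of u] up'[of "Suc s"] that s(2) by simp
      show "up D s \<noteq> up D (Suc s)" using up'[of "Suc s"] s(2,3) j by simp
    qed (use s(1,2) ta a in auto)
  qed
  have right: "up D t = up D a" if "a \<le> t" "Suc (Suc t) < length D" for t
    using that
  proof (induction t rule: less_induct)
    case (less t)
    show ?case
    proof (cases "Suc t < a + j")
      case True
      then show ?thesis using run less.prems by (cases "t = a") auto
    next
      case False
      define b where "b = Suc t - j"
      have b: "a \<le> b" "t = b + j - 1" using False j by (auto simp: b_def)
      have eq: "up D u = up D a" if "b \<le> u" "Suc u < b + j" for u
        using less.IH[of u] that b less.prems by simp
      show ?thesis
      proof (rule ccontr)
        assume "up D t \<noteq> up D a"
        then show False
        proof (intro run_end_False[OF assms(1) D, of b])
          show "up D u = up D b" if "b < u" "Suc u < b + j" for u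
            using eq[of u] eq[of b] that by simp
          show "up D (b + j - 1) \<noteq> up D b"
            using eq[of b] \<open>up D t \<noteq> up D a\<close> b(2) j by simp
          show "Suc (b + j) < length D" using less.prems b(2) j by simp
        qed
      qed
    qed
  qed
  have "up D s = up D a" if "1 \<le> s" "Suc (Suc s) < length D" for s
    using left[of s] right[of s] that by linarith
  then show ?thesis using t by simp
qed

text \<open>The window at \<open>i\<close> is an early turn of colour 0, so all later windows have
  colour 0. By \<open>long_run\<close> there is no run of \<open>j\<close> deltas at all. The zero
  colours of the next windows force constant signs up to a length just short of this, and the turn
  that must follow then sits in the late place of a window, whose colour is \<open>q - 1\<close>.
  That window starts at \<open>i + 4\<close> at the latest, which explains the additional 4.\<close>

lemma early_peak_False:
  assumes "blue vs" and D: "D = deltas vs"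
    and i: "i + j + 4 \<le> length D" "up D i = up D (i + 1)" "up D (i + 1) \<noteq> up D (i + 2)"
  shows False
proof -
  have no_run: "\<exists>t>a. Suc t < a + j \<and> up D t \<noteq> up D a" if a: "a + j \<le> length D" for a
  proof (rule ccontr)
    assume "\<not> ?thesis"
    then have "up D t = up D 1" if "1 \<le> t" "Suc (Suc t) < length D" for t
      using long_run[OF assms(1) D a _ that] by blast
    from this[of "i + 2"] this[of "i + 1"] show False using i(1,3) j by simp
  qed
  define W where "W b = take j (drop b D)" for b
  have upW: "up (W b) t = up D (b + t)" if "b + j \<le> length D" "Suc t < j" for b t
    using that by (simp add: W_def)
  have lW: "length (W b) = j" if "b + j \<le> length D" for b using that by (simp add: W_def)
  have "early_turn (W i)"
    using i j upW[of i 0] upW[of i 1] upW[of i 2] by (simp add: early_turn_def)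
  then have "F (W i) = 0" using F_early lW i by simp
  then have zero: "F (W b) = 0" if "i \<le> b" "b + j \<le> length D" for b
    using shift_antimono_windows[of j F vs i b] assms(1) that j by (simp add: W_def D)
  have late: False
    if b: "i \<le> b" "b + j \<le> length D" "\<And>t. 0 < t \<Longrightarrow> t < j - 3 \<Longrightarrow> up D (b + t) = up D b"
      "up D (b + j - 3) \<noteq> up D b" for b
  proof -
    have "up (W b) (j - 3) \<noteq> up (W b) 0"
      using b(4) upW[of b "j - 3"] upW[of b 0] b(2) j by simp
    then have "F (W b) = q - 1"
      using upW[of b] b(2,3) j by (intro F_late lW) simp_all
    then show False using zero b(1,2) q by simp
  qed
  define s1 where "s1 = up D (i + 2)"
  have l1: "Suc i + j \<le> length D" and l2: "i + 2 + j \<le> length D" using i(1) by simp_all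
  have t1: "up (W (Suc i)) 0 \<noteq> up (W (Suc i)) 1"
    using i(3) upW[OF l1, of 0] upW[OF l1, of 1] j by simp
  show False
  proof (cases "head_turn (W (Suc i))")
    \<comment> \<open>A head turn of colour 0 has its run in \<open>G\<close>.\<close>
    case True
    then have run: "up D t = s1" if "i + 2 \<le> t" "t < i + j" for t
    proof (cases "t = i + 2")
      case False
      define u where "u = t - Suc i"
      have u: "t = Suc i + u" "1 < u" "Suc u < j" using that False by (auto simp: u_def)
      have "up (W (Suc i)) u = up (W (Suc i)) 1"
        using True u lW[OF l1] by (simp add: head_turn_def)
      then show ?thesis using upW[OF l1, of u] upW[OF l1, of 1] u j by (simp add: s1_def)
    qed (simp add: s1_def)
    obtain t where t: "i + 2 < t" "Suc t < i + 2 + j" "up D t \<noteq> up D (i + 2)"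
      using no_run[OF l2] by blast
    have "t = i + j"
    proof (rule ccontr)
      assume "t \<noteq> i + j"
      then show False using run[of t] t by (simp add: s1_def)
    qed
    then have "up D (i + j) \<noteq> s1" using t by (simp add: s1_def)
    then show False
      by (intro late[of "i + 3"]) (use run i(1) j in \<open>auto simp: add.commute\<close>)
  next
    case False
    then have et: "early_turn (W (Suc i))"
      using F_zero_turn[OF lW[OF l1] t1] zero[of "Suc i"] l1 by simp
    define s2 where "s2 = up D (i + 3)"
    have s21: "s2 \<noteq> s1"
      using et upW[OF l1, of 1] upW[OF l1, of 2] j
      by (auto simp: early_turn_def s1_def s2_def numeral_3_eq_3 numeral_2_eq_2)
    have run: "up D t = s2" if "i + 3 \<le> t" "t < i + j" for t
    proof (cases "t = i + 3")
      case False
      define u where "u = t - Suc i"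
      have u: "t = Suc i + u" "2 < u" "Suc u < j" using that False by (auto simp: u_def)
      have "up (W (Suc i)) u = up (W (Suc i)) 2"
        using et t1 u(2,3) lW[OF l1] unfolding early_turn_def by blast
      then show ?thesis using upW[OF l1, of u] upW[OF l1, of 2] u j
        by (simp add: s2_def numeral_3_eq_3 numeral_2_eq_2)
    qed (simp add: s2_def)
    have W2: "up (W (i + 2)) 0 = s1" "up (W (i + 2)) 1 = s2" "up (W (i + 2)) 2 = s2"
      using upW[OF l2, of 0] upW[OF l2, of 1] upW[OF l2, of 2] run[of "i + 4"] j
      by (simp_all add: s1_def s2_def numeral_3_eq_3 numeral_2_eq_2 eval_nat_numeral)
    then have "\<not> early_turn (W (i + 2))" by (simp add: early_turn_def)
    then have "head_turn (W (i + 2))"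
      using F_zero_turn[OF lW[OF l2]] W2 s21 zero[of "i + 2"] l2 by auto
    then have "up (W (i + 2)) (j - 2) = up (W (i + 2)) 1" using j lW[OF l2] by (simp add: head_turn_def)
    then have "up D (i + 2 + (j - 2)) = s2" using upW[OF l2, of "j - 2"] W2 j by simp
    moreover have "i + 2 + (j - 2) = i + j" using j by simp
    ultimately have "up D (i + j) = s2" by metis
    then have run': "up D t = s2" if "i + 3 \<le> t" "t \<le> i + j" for t
      using run[of t] that by (cases "t = i + j") auto
    obtain t where t: "i + 3 < t" "Suc t < i + 3 + j" "up D t \<noteq> up D (i + 3)"
      using no_run[of "i + 3"] i(1) by auto
    have "t = Suc (i + j)"
    proof (rule ccontr)
      assume "t \<noteq> Suc (i + j)"
      then show False using run'[of t] t by (simp add: s2_def)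
    qed
    then have last: "up D (Suc (i + j)) \<noteq> s2" using t by (simp add: s2_def)
    show False
    proof (rule late[of "i + 4"])
      have "up D (i + 4) = s2" using run' j by simp
      then show "up D (i + 4 + t) = up D (i + 4)" if "0 < t" "t < j - 3" for t
        using run'[of "i + 4 + t"] that by simp
      have "i + 4 + j - 3 = Suc (i + j)" by simp
      then show "up D (i + 4 + j - 3) \<noteq> up D (i + 4)" using last \<open>up D (i + 4) = s2\<close> by metis
    qed (use i(1) in auto)
  qed
qed

text \<open>By \<open>early_peak_False\<close> two equal signs are followed by a third one, as long
  as there is room; this fills a run of \<open>j\<close> deltas, and \<open>long_run\<close> does
  the rest.\<close>

lemma early_double_run:
  assumes "blue vs" and D: "D = deltas vs"
    and i: "i + 2 * j \<le> length D" "up D i = up D (i + 1)"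
    and t: "1 \<le> t" "Suc (Suc t) < length D"
  shows "up D t = up D 1"
proof -
  have step: "up D (k + 2) = up D (k + 1)" if "k + j + 4 \<le> length D" "up D k = up D (k + 1)" for k
    using early_peak_False[OF assms(1) D that] by blast
  have run: "up D (i + k) = up D i \<and> up D (i + k + 1) = up D i" if "k + 3 \<le> j" for k
    using that
  proof (induction k)
    case (Suc k)
    then have "up D (i + k + 2) = up D (i + k + 1)" using i by (intro step) auto
    then show ?case using Suc by simp
  qed (use i in simp)
  have "up D u = up D i" if "i < u" "Suc u < i + j" for u
    using run[of "u - i - 1"] that by simp
  then show ?thesis
    by (intro long_run[OF assms(1) D _ _ t, of i]) (use i(1) in auto)
qed

text \<open>Two equal neighbouring signs near the beginning suffice by
  \<open>early_double_run\<close>. Otherwise the signs alternate there, and deleting one vertex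
  creates the pattern excluded by \<open>early_peak_False\<close>.\<close>

lemma blue_signs:
  assumes "blue vs" and D: "D = deltas vs" and l: "2 * j + 4 \<le> length D"
    and t: "1 \<le> t" "Suc (Suc t) < length D"
  shows "up D t = up D 1"
proof (cases "\<exists>i\<le>4. up D i = up D (i + 1)")
  case True
  then obtain i where "i \<le> 4" "up D i = up D (i + 1)" by blast
  then show ?thesis using early_double_run[OF assms(1) D _ _ t, of i] l by simp
next
  case False
  then have alt: "up D (Suc i) = (\<not> up D i)" if "i \<le> 4" for i using that by auto
  obtain p where p: "p \<le> 1" "up D p" using alt[of 0] by (cases "up D 0") auto
  have up: "up D p" "\<not> up D (p + 1)" "up D (p + 2)" "\<not> up D (p + 3)" "up D (p + 4)"
    using p alt[of p] alt[of "p + 1"] alt[of "p + 2"] alt[of "p + 3"] by (simp_all add: eval_nat_numeral)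
  have lvs: "p + 5 + j + 4 < length vs" using l p(1) D j by simp
  \<comment> \<open>The deleted vertex lies between the deltas
    \<open>D ! (p + 2) < D ! (p + 3)\<close>. They merge into their maximum, so just the smaller
    entry \<open>D ! (p + 2)\<close> disappears.\<close>
  define ws where "ws = take (p + 3) vs @ drop (p + 4) vs"
  have "vs = take (p + 3) vs @ vs ! (p + 3) # drop (p + 4) vs"
    using id_take_nth_drop[of "p + 3" vs] lvs by (simp add: eval_nat_numeral)
  then have sub: "subseq ws vs"
    unfolding ws_def by (metis list_emb_Cons subseq_append' subseq_order.order_refl)
  have bws: "blue ws"
    using assms(1) sub sorted_wrt_subseq shift_antimono_subseq by blast
  define E where "E = deltas ws"
  have lE: "Suc (length E) = length D" using lvs D by (simp add: E_def ws_def)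
  have nth_ws: "ws ! k = (if k < p + 3 then vs ! k else vs ! Suc k)" if "Suc k < length vs" for k
    using that lvs by (simp add: ws_def nth_append)
  have Ek: "E ! k = (if k < p + 2 then D ! k else D ! Suc k)" if k: "Suc (Suc k) < length vs" for k
  proof -
    have len: "Suc k < length ws" using k lvs by (simp add: ws_def)
    have Ed: "E ! k = delta (ws ! k) (ws ! Suc k)" using len by (simp add: E_def nth_deltas)
    consider "k < p + 2" | "k = p + 2" | "k > p + 2" by linarith
    then show ?thesis
    proof cases
      case 2
      have "vs ! (p + 2) < vs ! (p + 3)" "vs ! (p + 3) < vs ! (p + 4)"
        using assms(1) lvs by (simp_all add: sorted_wrt_nth_less)
      then have "delta (vs ! (p + 2)) (vs ! (p + 4)) = max (D ! (p + 2)) (D ! (p + 3))"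
        using delta_max lvs D by (simp add: nth_deltas eval_nat_numeral)
      also have "\<dots> = D ! (p + 3)" using up(3) by (simp add: up_def eval_nat_numeral)
      finally show ?thesis using 2 Ed nth_ws[of k] nth_ws[of "Suc k"] k by (simp add: eval_nat_numeral)
    qed (use Ed nth_ws[of k] nth_ws[of "Suc k"] k D in \<open>simp_all add: nth_deltas\<close>)
  qed
  have E: "E ! p = D ! p" "E ! (p + 1) = D ! (p + 1)" "E ! (p + 2) = D ! (p + 3)"
    "E ! (p + 3) = D ! (p + 4)" "E ! (p + 4) = D ! (p + 5)"
    using Ek[of p] Ek[of "p + 1"] Ek[of "p + 2"] Ek[of "p + 3"] Ek[of "p + 4"] lvs
    by (simp_all add: eval_nat_numeral)
  have upE: "up E p" "up E (p + 1) \<longleftrightarrow> D ! (p + 1) < D ! (p + 3)" "\<not> up E (p + 2)" "up E (p + 3)"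
    using up E by (simp_all add: up_def eval_nat_numeral)
  \<comment> \<open>From place \<open>p\<close> on, the signs of \<open>E\<close> are up, unknown,
    down, up. The unknown one completes either up-up-down or down-down-up.\<close>
  have False
  proof (cases "up E (p + 1)")
    case True
    then show False
      by (intro early_peak_False[OF bws E_def, of p]) (use upE lE l p(1) j in auto)
  next
    case False
    then show False
      by (intro early_peak_False[OF bws E_def, of "p + 1"])
         (use upE lE l p(1) j in \<open>auto simp: eval_nat_numeral\<close>)
  qed
  then show ?thesis ..
qed

text \<open>The interior signs agree by \<open>blue_signs\<close>. If an end sign agreed with them
  too, there would be \<open>n\<close> consecutive monotone deltas, against
  \<open>no_long_run\<close>.\<close>

lemma extremal_signs:
  assumes "blue vs" "set vs \<subseteq> {..<2 ^ N}" "length vs = n + 2" and D: "D = deltas vs"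
  shows "up D 0 \<noteq> up D 1" "up D (n - 1) \<noteq> up D 1"
    and "\<And>t. 1 \<le> t \<Longrightarrow> t + 2 \<le> n \<Longrightarrow> up D t = up D 1"
proof -
  have vs: "sorted_wrt (<) vs" "shift_antimono (Suc j) (\<lambda>us. F (deltas us)) vs"
    using assms(1) by blast+
  have lD: "length D = n + 1" using assms(3) D by simp
  show *: "up D t = up D 1" if "1 \<le> t" "t + 2 \<le> n" for t
    using blue_signs[OF assms(1) D _ that(1)] that(2) lD n by simp
  have no_run: False if "a \<le> 1" "\<And>t. a < t \<Longrightarrow> Suc t < a + n \<Longrightarrow> up D t = up D a" for a
  proof -
    show False
    proof (rule no_long_run[where \<chi> = \<chi> and c = "q - 1" and a = a and F = F, OF _ \<chi> vs(1) assms(2) vs(2)])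
      show "\<chi> us \<le> q - 1" for us using \<chi>_less[of us] by simp
      show "monotone_list (take n (drop a (deltas vs)))"
        using that lD D by (intro monotone_window_up[OF vs(1)]) auto
      show "F X = \<chi> X" if "sorted_wrt (<) X" for X using F_increasing that .
      show "F X = q - 1 - \<chi> (rev X)" if "sorted_wrt (>) X" "length X = j" for X
        using F_decreasing that j by simp
    qed (use n lD that(1) D in auto)
  qed
  show "up D 0 \<noteq> up D 1"
  proof
    assume eq: "up D 0 = up D 1"
    have "up D t = up D 0" if "0 < t" "Suc t < n" for t
      using eq *[of t] that by simp
    then show False using no_run[of 0] by simp
  qed
  show "up D (n - 1) \<noteq> up D 1"
  proof
    assume eq: "up D (n - 1) = up D 1"
    have "up D t = up D 1" if "1 < t" "Suc t < 1 + n" for t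
      using eq *[of t] that by (cases "t = n - 1") auto
    then show False using no_run[of 1] by simp
  qed
qed

text \<open>Removing the last or the first vertex leaves an extremal list each time. Signs 1 and 2
  are interior in the former, hence equal, but they are the first two in the latter, hence
  different.\<close>

lemma no_blue:
  assumes "blue vs" "set vs \<subseteq> {..<2 ^ N}" "length vs = n + 3"
  shows False
proof -
  have sub: "blue us \<and> set us \<subseteq> {..<2 ^ N}" if "subseq us vs" for us
    using that assms sorted_wrt_subseq shift_antimono_subseq set_subseq by blast
  have s1: "subseq (take (n + 2) vs) vs" by (intro prefix_imp_subseq take_is_prefix)
  have s2: "subseq (tl vs) vs" by (rule subseq_tl)
  have "deltas (take (n + 2) vs) = take (n + 1) (deltas vs)"
    using deltas_take[of "n + 1" vs] by simp
  moreover have "up (deltas (take (n + 2) vs)) 2 = up (deltas (take (n + 2) vs)) 1"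
    using sub[OF s1] n j assms(3) by (intro extremal_signs(3)[OF _ _ _ refl]) auto
  ultimately have "up (deltas vs) 2 = up (deltas vs) 1"
    using n j by simp
  moreover have "up (deltas (tl vs)) 0 \<noteq> up (deltas (tl vs)) 1"
  proof (rule extremal_signs(1)[OF _ _ _ refl])
    show "blue (tl vs)" "set (tl vs) \<subseteq> {..<2 ^ N}" using sub[OF s2] by blast+
    show "length (tl vs) = n + 2" using assms(3) by simp
  qed
  moreover have "up (deltas (tl vs)) 0 = up (deltas vs) 1" "up (deltas (tl vs)) 1 = up (deltas vs) 2"
  proof -
    have len: "Suc (Suc 0) < length (deltas vs)" "Suc (Suc 1) < length (deltas vs)"
      using assms(3) n j by simp_all
    show "up (deltas (tl vs)) 0 = up (deltas vs) 1" "up (deltas (tl vs)) 1 = up (deltas vs) 2"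
      using up_tl[OF len(1)] up_tl[OF len(2)] by (simp_all only: deltas_tl One_nat_def numeral_2_eq_2)
  qed
  ultimately show False by blast
qed

end

text \<open>The signals of the second step: with \<open>Y\<close> the first or last \<open>j\<close> elements of a monotone run that is
  exceptional for the first step, the colour of the \<open>Suc j\<close> outermost elements is known.\<close>

definition peak_sets :: "nat \<Rightarrow> nat list set" where
  "peak_sets j = {Y. length Y = j \<and>
     (sorted_wrt (>) Y \<and> (\<forall>t<j - 3. up (deltas (rev Y)) t) \<and> \<not> up (deltas (rev Y)) (j - 3) \<or>
      sorted_wrt (<) Y \<and> up (deltas Y) 0 \<and> (\<forall>t. 0 < t \<longrightarrow> t \<le> j - 3 \<longrightarrow> \<not> up (deltas Y) t))}"

lemma not_increasing_and_decreasing: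
  assumes "sorted_wrt (<) (Y :: nat list)" "sorted_wrt (>) Y" "2 \<le> length Y"
  shows False
  using up_increasing[OF assms(1), of 0] not_up_decreasing[OF assms(2), of 0] assms(3) by simp

text \<open>Membership in \<open>peak_sets\<close> requires a turn of the deltas next to the head.
  \<open>X\<close> without its last entry and \<open>X\<close> without its second entry both keep
  the head; if the former has this turn, then in the latter the outermost delta there has been
  absorbed, and the turn is gone.\<close>

lemma peak_sets_avoidable:
  assumes X: "monotone_list X" "length X = Suc j" and j: "5 \<le> j"
  shows "\<exists>Y. subseq Y X \<and> length Y = j \<and> hd Y = hd X \<and> Y \<notin> peak_sets j"
proof (cases "butlast X \<in> peak_sets j")
  case False
  moreover have "hd (butlast X) = hd X" using X(2) j by (cases X; cases "tl X") auto
  ultimately show ?thesis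
    using X(2) subseq_butlast by (intro exI[of _ "butlast X"]) auto
next
  case True
  show ?thesis
  proof (cases "sorted_wrt (<) X")
    case inc: True
    then have sb: "sorted_wrt (<) (butlast X)" using sorted_wrt_subseq subseq_butlast by blast
    then have "\<not> sorted_wrt (>) (butlast X)"
      using not_increasing_and_decreasing[of "butlast X"] X(2) j by auto
    moreover have "deltas (butlast X) = take (j - 1) (deltas X)"
      using X(2) j deltas_take[of "j - 1" X] by (simp add: butlast_conv_take)
    ultimately have up: "up (deltas X) 0" "\<not> up (deltas X) 1"
      using True j by (auto simp: peak_sets_def dest!: spec[of _ 1])
    obtain a b c Z where Xe: "X = a # b # c # Z"
      using X(2) j by (cases X; cases "tl X"; cases "tl (tl X)") auto
    have "a < b" "b < c" using inc Xe by auto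
    then have "delta a c = delta b c"
      using up(1) Xe delta_max[of a b c] by (simp add: up_def)
    then have "deltas (a # c # Z) = tl (deltas X)" by (simp add: Xe)
    then have "\<not> up (deltas (a # c # Z)) 0" using up(2) X(2) j by simp
    moreover have "sorted_wrt (<) (a # c # Z)" using inc Xe by auto
    ultimately have "a # c # Z \<notin> peak_sets j"
      using not_increasing_and_decreasing[of "a # c # Z"] by (auto simp: peak_sets_def)
    then show ?thesis using X(2) Xe by (intro exI[of _ "a # c # Z"]) auto
  next
    case False
    then have dec: "sorted_wrt (>) X" using X(1) by (simp add: monotone_list_def)
    define Z where "Z = rev X"
    define e where "e = deltas Z"
    have le: "length e = j" using X(2) by (simp add: e_def Z_def)
    have sZ: "sorted_wrt (<) Z" using dec by (simp add: Z_def sorted_wrt_rev)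
    have sb: "sorted_wrt (>) (butlast X)" using dec sorted_wrt_subseq subseq_butlast by blast
    have "rev (butlast X) = tl Z" by (metis Z_def butlast_rev rev_rev_ident)
    then have "deltas (rev (butlast X)) = tl e" by (simp add: e_def deltas_tl)
    then have tl: "\<forall>t<j - 3. up (tl e) t" "\<not> up (tl e) (j - 3)"
      using True sb not_increasing_and_decreasing[of "butlast X"] X(2) j
      by (auto simp: peak_sets_def)
    have "Suc (j - 4) = j - 3" "Suc (j - 3) = j - 2" using j by auto
    then have up: "up e (j - 3)" "\<not> up e (j - 2)"
      using tl(1)[rule_format, of "j - 4"] tl(2) le j by (simp_all)
    obtain Z0 a b c where Ze: "Z = Z0 @ [a, b, c]"
    proof -
      have "length Z = Suc j" using X(2) by (simp add: Z_def)
      then obtain c Z1 where "Z = Z1 @ [c]" "length Z1 = j" by (cases Z rule: rev_cases) auto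
      moreover from this obtain b Z2 where "Z1 = Z2 @ [b]" "length Z2 = j - 1"
        using j by (cases Z1 rule: rev_cases) auto
      moreover from this obtain a Z3 where "Z2 = Z3 @ [a]"
        using j by (cases Z2 rule: rev_cases) auto
      ultimately show ?thesis using that by simp
    qed
    have "length Z = length Z0 + 3" by (simp add: Ze)
    then have lZ0: "length Z0 = j - 2" using X(2) by (simp add: Z_def)
    have abc: "a < b" "b < c" using sZ Ze by (auto simp: sorted_wrt_append)
    have e: "e = deltas (Z0 @ [a]) @ [delta a b, delta b c]"
      using deltas_snoc[of "Z0 @ [a]" b c] deltas_snoc[of Z0 a b] by (simp add: e_def Ze)
    have "delta a b \<ge> delta b c"
      using up(2) e lZ0 j by (auto simp: up_def nth_append Suc_diff_le numeral_2_eq_2)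
    then have "delta a c = delta a b" using delta_max[OF abc] by simp
    then have D: "deltas (Z0 @ [a, c]) = take (j - 1) e"
      using deltas_snoc[of Z0 a c] e lZ0 j by simp
    define Y where "Y = c # a # rev Z0"
    have rY: "rev Y = Z0 @ [a, c]" by (simp add: Y_def)
    have Xe: "X = c # b # a # rev Z0" using arg_cong[OF Ze, of rev] by (simp add: Z_def)
    have "up (deltas (rev Y)) (j - 3)" unfolding rY D using up(1) j by simp
    moreover have "sorted_wrt (>) Y" using dec Xe by (auto simp: Y_def)
    ultimately have "Y \<notin> peak_sets j"
      using not_increasing_and_decreasing[of Y] by (auto simp: peak_sets_def Y_def)
    then show ?thesis using X(2) Xe by (intro exI[of _ Y]) (auto simp: Y_def)
  qed
qed

section \<open>Two refined steps at a joint cost of five\<close>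

lemma take_rev_eq: "m \<le> length xs \<Longrightarrow> take m (rev xs) = rev (drop (length xs - m) xs)"
  by (simp add: rev_drop)

text \<open>Two applications of \<open>no_blue\<close> would yield \<open>n + 6\<close>. A surviving
  set of size \<open>n + 5\<close> is extremal for the second step, and its inner run of
  \<open>n + 2\<close> deltas is extremal for the first. One end of this run belongs to
  \<open>peak_sets j\<close>, and there the swapped colour conflicts with the colour inherited from
  the first step.\<close>

lemma avoidable_step_tight:
  assumes "avoidable q j n N" and q: "2 \<le> q" and j: "6 \<le> j" and n: "2 * j + 3 \<le> n"
  shows "avoidable q (Suc j) (n + 3) (2 ^ N)" "avoidable q (Suc (Suc j)) (n + 5) (2 ^ 2 ^ N)"
proof -
  obtain \<chi> where \<chi>: "\<And>us. \<chi> us < q"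
    "\<And>vs. sorted_wrt (<) vs \<Longrightarrow> set vs \<subseteq> {..<N} \<Longrightarrow> length vs = n \<Longrightarrow> \<not> shift_antimono j \<chi> vs"
    using assms(1) unfolding avoidable_def by blast
  have "\<exists>Y. subseq Y X \<and> length Y = j - 1 \<and> hd Y = hd X \<and> Y \<notin> {}"
    if "length X = j" for X :: "nat list"
  proof (intro exI conjI)
    show "hd (butlast X) = hd X" using that j by (cases X; cases "tl X") auto
  qed (use that subseq_butlast in auto)
  then interpret A: tight_step q j n N \<chi> "{}"
    using \<chi> q j n by unfold_locales auto
  define \<chi>' where "\<chi>' us = A.F (deltas us)" for us
  have \<chi>': "\<And>us. \<chi>' us < q"
    "\<And>vs. sorted_wrt (<) vs \<Longrightarrow> set vs \<subseteq> {..<2 ^ N} \<Longrightarrow> length vs = n + 3 \<Longrightarrow> \<not> shift_antimono (Suc j) \<chi>' vs"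
    using A.F_less A.no_blue unfolding \<chi>'_def by blast+
  then show "avoidable q (Suc j) (n + 3) (2 ^ N)" unfolding avoidable_def by blast
  interpret B: tight_step q "Suc j" "n + 3" "2 ^ N" \<chi>' "peak_sets j"
    using \<chi>' q j n peak_sets_avoidable[of _ j] by unfold_locales auto
  have "\<not> shift_antimono (Suc (Suc j)) (\<lambda>us. B.F (deltas us)) W"
    if W: "sorted_wrt (<) W" "set W \<subseteq> {..<2 ^ 2 ^ N}" "length W = n + 5" for W
  proof
    assume anti: "shift_antimono (Suc (Suc j)) (\<lambda>us. B.F (deltas us)) W"
    define D where "D = deltas W"
    have lD: "length D = n + 4" using W(3) by (simp add: D_def)
    have ext: "up D 0 \<noteq> up D 1" "up D (n + 2) \<noteq> up D 1"
      "\<And>t. 1 < t \<Longrightarrow> t \<le> n + 1 \<Longrightarrow> up D t = up D 1"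
    proof -
      have b: "B.blue W" "set W \<subseteq> {..<2 ^ 2 ^ N}" "length W = n + 3 + 2"
        using W anti by simp_all
      show "up D 0 \<noteq> up D 1" by (rule B.extremal_signs(1)[OF b D_def])
      show "up D (n + 2) \<noteq> up D 1" using B.extremal_signs(2)[OF b D_def] by simp
      show "up D t = up D 1" if "1 < t" "t \<le> n + 1" for t
        by (rule B.extremal_signs(3)[OF b D_def]) (use that in auto)
    qed
    define E0 where "E0 = take (n + 2) (drop 1 D)"
    have lE0: "length E0 = n + 2" using lD by (simp add: E0_def)
    have mE0: "monotone_list E0"
      unfolding E0_def D_def
      by (rule monotone_window_up[OF W(1)]) (use lD ext(3) in \<open>auto simp: D_def\<close>)
    define us where "us = take (n + 3) (drop 1 W)"
    have usub: "subseq us W" unfolding us_def by (rule subseq_window)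
    have us: "sorted_wrt (<) us" "set us \<subseteq> {..<2 ^ 2 ^ N}"
      "shift_antimono (Suc (Suc j)) (\<lambda>us. B.F (deltas us)) us"
      using sorted_wrt_subseq[OF W(1) usub] set_subseq[OF usub] W(2) shift_antimono_subseq[OF anti usub]
      by blast+
    have Dus: "deltas us = E0"
      using deltas_window[of "n + 2" 1 W] by (simp add: us_def E0_def D_def numeral_3_eq_3)
    \<comment> \<open>The first step colours decreasing runs through \<open>rev\<close>, so it
      always judges the run read upwards.\<close>
    define E where "E = (if sorted_wrt (<) E0 then E0 else rev E0)"
    have lE: "length E = n + 2" using lE0 by (simp add: E_def)
    have sE: "sorted_wrt (<) E" using mE0 by (auto simp: E_def monotone_list_def sorted_wrt_rev)
    have setE: "set E \<subseteq> {..<2 ^ N}" using set_deltas[OF us(1,2)] Dus by (simp add: E_def)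
    have antiE: "shift_antimono (Suc j) \<chi>' E"
    proof (cases "sorted_wrt (<) E0")
      case True
      then show ?thesis
        using increasing_run[of "Suc j" B.F us \<chi>'] us Dus B.F_increasing by (simp add: E_def)
    next
      case False
      then have "sorted_wrt (>) E0" using mE0 by (simp add: monotone_list_def)
      moreover have "\<chi>' X \<le> q - 1" for X using \<chi>'(1)[of X] by simp
      ultimately show ?thesis
        using decreasing_run[of "Suc j" B.F us "q - 1" \<chi>'] us Dus B.F_decreasing j False
        by (simp add: E_def)
    qed
    define e where "e = deltas E"
    have le: "length e = n + 1" using lE by (simp add: e_def)
    define s where "s = up e 1"
    have e: "up e 0 = (\<not> s)" "up e (n - 1) = (\<not> s)" "\<And>t. 1 \<le> t \<Longrightarrow> t + 2 \<le> n \<Longrightarrow> up e t = s"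
    proof -
      have b: "A.blue E" using sE antiE unfolding \<chi>'_def by simp
      show "up e 0 = (\<not> s)" using A.extremal_signs(1)[OF b setE lE e_def] by (auto simp: s_def)
      show "up e (n - 1) = (\<not> s)" using A.extremal_signs(2)[OF b setE lE e_def] by (auto simp: s_def)
      show "up e t = s" if "1 \<le> t" "t + 2 \<le> n" for t
        using A.extremal_signs(3)[OF b setE lE e_def that] by (simp add: s_def)
    qed
    define first where "first m = take m E" for m
    define final where "final m = drop (n + 2 - m) E" for m
    have \<chi>'_first: "\<chi>' (first (Suc j)) = q - 1"
    proof -
      have d: "deltas (first (Suc j)) = take j e" by (simp add: first_def e_def deltas_take)
      have "head_turn (take j e)"
        using e(1) e(3)[of 1] e(3) le n j by (simp add: head_turn_def)
      then show ?thesis unfolding \<chi>'_def d using A.F_head le n by simp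
    qed
    have \<chi>'_final: "\<chi>' (final (Suc j)) = 0"
    proof -
      have d: "deltas (final (Suc j)) = drop (n + 1 - j) e" by (simp add: final_def e_def deltas_drop)
      define V where "V = drop (n + 1 - j) e"
      have lV: "length V = j" using le n by (simp add: V_def)
      have up: "up V t = up e (n + 1 - j + t)" if "Suc t < j" for t
        using that le n by (simp add: V_def)
      have "up V t = s" if "Suc (Suc t) < j" for t
        using up[of t] e(3)[of "n + 1 - j + t"] that n by simp
      moreover have "n + 1 - j + (j - 2) = n - 1" using n j by simp
      then have "up V (j - 2) = (\<not> s)"
        using up[of "j - 2"] e(2) j by simp
      ultimately have "tail_turn V"
        using lV j by (simp add: tail_turn_def)
      then show ?thesis unfolding \<chi>'_def d V_def[symmetric] using A.F_tail lV by simp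
    qed
    \<comment> \<open>The deltas of \<open>E\<close> have their peak at the first turn if
      \<open>s\<close> is false and at the last turn if \<open>s\<close> is true, so exactly the
      value of \<open>s\<close> decides which end is marked.\<close>
    have peak_first: "first j \<in> peak_sets j" if "\<not> s"
    proof -
      have d: "deltas (first j) = take (j - 1) e"
        using deltas_take[of "j - 1" E] j by (simp add: first_def e_def)
      have "up (deltas (first j)) 0" unfolding d using e(1) \<open>\<not> s\<close> j by simp
      moreover have "\<not> up (deltas (first j)) t" if "0 < t" "t \<le> j - 3" for t
        unfolding d using e(3)[of t] that \<open>\<not> s\<close> n j by simp
      moreover have "sorted_wrt (<) (first j)" using sE by (simp add: first_def sorted_wrt_take)
      ultimately show ?thesis using lE n j by (simp add: peak_sets_def first_def)
    qed
    have peak_final: "rev (final j) \<in> peak_sets j" if "s"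
    proof -
      have d: "deltas (final j) = drop (n + 2 - j) e" by (simp add: final_def e_def deltas_drop)
      have up: "up (deltas (final j)) t = up e (n + 2 - j + t)" if "t \<le> j - 3" for t
        unfolding d using that le n j by simp
      have "up (deltas (final j)) t" if "t < j - 3" for t
        using up[of t] e(3)[of "n + 2 - j + t"] that \<open>s\<close> n by simp
      moreover have "n + 2 - j + (j - 3) = n - 1" using n j by simp
      then have "\<not> up (deltas (final j)) (j - 3)"
        using up[of "j - 3"] e(2) \<open>s\<close> by simp
      moreover have "sorted_wrt (<) (final j)" using sE by (simp add: final_def sorted_wrt_drop)
      ultimately show ?thesis using lE n j by (simp add: peak_sets_def final_def sorted_wrt_rev)
    qed
    have win: "B.F (take (Suc j) (drop i' D)) \<le> B.F (take (Suc j) (drop i D))"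
      if "i \<le> i'" "i' + Suc j \<le> n + 4" for i i'
      unfolding D_def using that lD by (intro shift_antimono_windows[OF anti]) (auto simp: D_def)
    \<comment> \<open>The marked head turn gets 0 instead of \<open>q - 1\<close>, and the next
      window, inside the run, has colour \<open>q - 1\<close>.\<close>
    have head_False: False if "take j E0 \<in> peak_sets j" "B.F (take (Suc j) E0) = q - 1"
    proof -
      have "head_turn (take (Suc j) D)"
        using ext(1,3) lD n j by (simp add: head_turn_def)
      moreover have "tl (take (Suc j) D) = take j E0"
        using n lD by (simp add: E0_def tl_take drop_Suc)
      ultimately have "B.F (take (Suc j) D) = 0"
        using B.F_head[of "take (Suc j) D"] that(1) lD n by simp
      moreover have "take (Suc j) (drop 1 D) = take (Suc j) E0" using n by (simp add: E0_def)
      ultimately show False using win[of 0 1] that(2) q n by simp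
    qed
    \<comment> \<open>The marked tail turn gets \<open>q - 1\<close> instead of 0, and the window
      before it, inside the run, has colour 0.\<close>
    have tail_False: False
      if "rev (drop (n + 2 - j) E0) \<in> peak_sets j" "B.F (drop (n + 1 - j) E0) = 0"
    proof -
      define V where "V = drop (n + 3 - j) D"
      have lV: "length V = Suc j" using lD n by (simp add: V_def)
      have upV: "up V t = up D (n + 3 - j + t)" if "t < j" for t
        using that lD n by (simp add: V_def)
      have "up V t = up D 1" if "t < j - 1" for t
        using upV[of t] ext(3)[of "n + 3 - j + t"] that n by simp
      moreover have "n + 3 - j + (j - 1) = n + 2" using n j by simp
      then have "up V (j - 1) \<noteq> up D 1" using upV[of "j - 1"] ext(2) j by simp
      ultimately have "tail_turn V" using lV j by (simp add: tail_turn_def)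
      moreover have "butlast V = drop (n + 2 - j) E0"
      proof (rule nth_equalityI)
        fix k assume "k < length (butlast V)"
        then have "k < j" using lV by simp
        then have "butlast V ! k = D ! (n + 3 - j + k)"
          using lV lD n by (simp add: nth_butlast V_def)
        moreover have "drop (n + 2 - j) E0 ! k = D ! (1 + (n + 2 - j + k))"
          using \<open>k < j\<close> lD n lE0 by (simp add: E0_def)
        moreover have "n + 3 - j + k = 1 + (n + 2 - j + k)" using n by simp
        ultimately show "butlast V ! k = drop (n + 2 - j) E0 ! k" by metis
      qed (use lV lE0 n in auto)
      ultimately have "B.F V = q - 1" using B.F_tail[OF lV] that(1) by simp
      moreover have "take (Suc j) (drop (n + 3 - j) D) = V" using lV by (simp add: V_def)
      moreover have "take (Suc j) (drop (n + 2 - j) D) = drop (n + 1 - j) E0"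
      proof (rule nth_equalityI)
        fix k assume "k < length (take (Suc j) (drop (n + 2 - j) D))"
        then have "k < Suc j" by simp
        then have "take (Suc j) (drop (n + 2 - j) D) ! k = D ! (n + 2 - j + k)"
          using lD n by simp
        moreover have "drop (n + 1 - j) E0 ! k = D ! (1 + (n + 1 - j + k))"
          using \<open>k < Suc j\<close> lD n lE0 by (simp add: E0_def)
        moreover have "n + 2 - j + k = 1 + (n + 1 - j + k)" using n by simp
        ultimately show "take (Suc j) (drop (n + 2 - j) D) ! k = drop (n + 1 - j) E0 ! k" by metis
      qed (use lD lE0 n in auto)
      moreover have "n + 2 - j \<le> n + 3 - j" "n + 3 - j + Suc j \<le> n + 4" using n by linarith+
      ultimately show False using win[of "n + 2 - j" "n + 3 - j"] that(2) q by simp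
    qed
    have rev_first: "take m E0 = rev (final m)" "rev (drop (n + 2 - m) E0) = first m"
      if "E0 = rev E" "m \<le> n + 2" for m
      using that lE take_rev_eq[of m E] by (simp_all add: final_def first_def rev_drop)
    show False
    proof (cases "sorted_wrt (<) E0")
      case True
      then have E0: "E0 = E" by (simp add: E_def)
      have F: "B.F (first (Suc j)) = q - 1" "B.F (final (Suc j)) = 0"
        using B.F_increasing \<chi>'_first \<chi>'_final sE
        by (simp_all add: first_def final_def sorted_wrt_take sorted_wrt_drop)
      show False
      proof (cases s)
        case True
        then show False using tail_False peak_final F(2) by (simp add: E0 final_def)
      next
        case False
        then show False using head_False peak_first F(1) by (simp add: E0 first_def)
      qed
    next
      case False
      then have E0: "E0 = rev E" and dec: "sorted_wrt (>) E0"
        using mE0 by (simp_all add: E_def monotone_list_def)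
      \<comment> \<open>Reversal exchanges the two ends of the run and also complements their
        colours, so the same two conflicts cover the decreasing case.\<close>
      have "sorted_wrt (>) (rev (first (Suc j)))" "sorted_wrt (>) (rev (final (Suc j)))"
        using sE by (simp_all add: first_def final_def sorted_wrt_take sorted_wrt_drop sorted_wrt_rev)
      moreover have "length (first (Suc j)) = Suc j" "length (final (Suc j)) = Suc j"
        using lE n by (simp_all add: first_def final_def)
      ultimately have F: "B.F (rev (first (Suc j))) = 0" "B.F (rev (final (Suc j))) = q - 1"
        using B.F_decreasing \<chi>'_first \<chi>'_final j by simp_all
      show False
      proof (cases s)
        case True
        then show False
          using head_False peak_final F(2) rev_first(1)[OF E0, of j] rev_first(1)[OF E0, of "Suc j"] n by simp
      next
        case False
        have "drop (n + 1 - j) E0 = rev (first (Suc j))"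
          using rev_first(2)[OF E0, of "Suc j"] n by (simp add: rev_swap)
        then show False
          using tail_False peak_first[OF False] F(1) rev_first(2)[OF E0, of j] n by simp
      qed
    qed
  qed
  then show "avoidable q (Suc (Suc j)) (n + 5) (2 ^ 2 ^ N)"
    unfolding avoidable_def using B.F_less by (intro exI[of _ "\<lambda>us. B.F (deltas us)"]) simp
qed

section \<open>Lower bounds for uniformity at most three\<close>

lemma card_restricted_colourings:
  assumes "finite E" "E' \<subseteq> E"
  shows "card (PiE E (\<lambda>e. if e \<in> E' then C' else C)) = card C' ^ card E' * card C ^ (card E - card E')"
proof -
  have "card (PiE E (\<lambda>e. if e \<in> E' then C' else C)) = (\<Prod>e\<in>E. if e \<in> E' then card C' else card C)"
    using assms(1) by (subst card_PiE) (auto intro: prod.cong)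
  also have "\<dots> = (\<Prod>e\<in>E'. card C') * (\<Prod>e\<in>E - E'. card C)"
    using assms by (subst prod.If_cases) (auto simp: Int_absorb1 Diff_eq)
  also have "\<dots> = card C' ^ card E' * card C ^ (card E - card E')"
    using finite_subset[OF assms(2,1)] assms(2) by (simp add: card_Diff_subset)
  finally show ?thesis .
qed

lemma card_nsets_lessThan: "card ([{..<N}]\<^bsup>n\<^esup>) \<le> N ^ n"
  by (cases "n \<le> N") (simp_all add: binomial_le_pow binomial_eq_0)

text \<open>The first-moment bound in counting form: a union bound over all \<open>n\<close>-sets,
  each edge contributing the ratio of the two palettes.\<close>

lemma card_monochromatic_colourings:
  fixes N j n :: nat and C C' :: "nat set"
  defines "E \<equiv> [{..<N}]\<^bsup>j\<^esup>"
  assumes "finite C" "C' \<subseteq> C" "C \<noteq> {}"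
  shows "real (card {f \<in> PiE E (\<lambda>_. C). \<exists>K\<in>[{..<N}]\<^bsup>n\<^esup>. \<forall>e\<in>[K]\<^bsup>j\<^esup>. f e \<in> C'})
    \<le> real N ^ n * (real (card C') / real (card C)) ^ (n choose j) * real (card C) ^ card E"
proof -
  let ?bad = "\<lambda>K. PiE E (\<lambda>e. if e \<in> [K]\<^bsup>j\<^esup> then C' else C)"
  have fE: "finite E" by (simp add: E_def finite_imp_finite_nsets)
  have fin: "finite ([{..<N}]\<^bsup>n\<^esup>)" by (simp add: finite_imp_finite_nsets)
  have cC: "real (card C) > 0" using assms by (simp add: card_gt_0_iff)
  have sub: "{f \<in> PiE E (\<lambda>_. C). \<exists>K\<in>[{..<N}]\<^bsup>n\<^esup>. \<forall>e\<in>[K]\<^bsup>j\<^esup>. f e \<in> C'} \<subseteq> (\<Union>K\<in>[{..<N}]\<^bsup>n\<^esup>. ?bad K)"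
    using assms(3) by (fastforce simp: PiE_iff)
  have card_bad: "real (card (?bad K)) = (real (card C') / real (card C)) ^ (n choose j) * real (card C) ^ card E"
    if K: "K \<in> [{..<N}]\<^bsup>n\<^esup>" for K
  proof -
    have KE: "[K]\<^bsup>j\<^esup> \<subseteq> E" using K unfolding E_def nsets_def by auto
    have cK: "card ([K]\<^bsup>j\<^esup>) = n choose j" using K by (auto simp: nsets_def[of _ n])
    have "card ([K]\<^bsup>j\<^esup>) \<le> card E" using KE fE by (rule card_mono[rotated])
    then have "real (card C) ^ (card E - (n choose j)) = real (card C) ^ card E / real (card C) ^ (n choose j)"
      using cK cC by (intro power_diff) auto
    then show ?thesis
      using card_restricted_colourings[OF fE KE, of C' C] cK
      by (simp only: of_nat_mult of_nat_power) (simp add: power_divide)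
  qed
  have "real (card {f \<in> PiE E (\<lambda>_. C). \<exists>K\<in>[{..<N}]\<^bsup>n\<^esup>. \<forall>e\<in>[K]\<^bsup>j\<^esup>. f e \<in> C'})
    \<le> real (card (\<Union>K\<in>[{..<N}]\<^bsup>n\<^esup>. ?bad K))"
  proof -
    have "finite (\<Union>K\<in>[{..<N}]\<^bsup>n\<^esup>. ?bad K)"
      using fin fE assms(2,3) finite_subset by (intro finite_UN_I finite_PiE) auto
    then show ?thesis using card_mono[OF _ sub] by simp
  qed
  also have "\<dots> \<le> real (\<Sum>K\<in>[{..<N}]\<^bsup>n\<^esup>. card (?bad K))"
    using card_UN_le[OF fin] of_nat_le_iff by blast
  also have "\<dots> = real (card ([{..<N}]\<^bsup>n\<^esup>)) * ((real (card C') / real (card C)) ^ (n choose j) * real (card C) ^ card E)"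
    using card_bad by simp
  also have "\<dots> \<le> real N ^ n * ((real (card C') / real (card C)) ^ (n choose j) * real (card C) ^ card E)"
    using card_nsets_lessThan[of N n] by (intro mult_right_mono) (simp_all flip: of_nat_power)
  finally show ?thesis by (simp only: mult.assoc)
qed

text \<open>A biased coin by plain counting: colour uniformly with \<open>m\<close> colours and
  merge \<open>1, ..., m - 1\<close>, so that colour 0 has density \<open>1 / m\<close>.\<close>

lemma random_two_colouring:
  assumes "2 \<le> m"
    and less: "real N ^ n0 / real m ^ (n0 choose j) + real N ^ n1 * (1 - 1 / real m) ^ (n1 choose j) < 1"
  obtains f :: "nat set \<Rightarrow> nat"
  where "\<And>e. f e < 2" "\<And>K. K \<in> [{..<N}]\<^bsup>n0\<^esup> \<Longrightarrow> \<exists>e\<in>[K]\<^bsup>j\<^esup>. f e \<noteq> 0"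
    "\<And>K. K \<in> [{..<N}]\<^bsup>n1\<^esup> \<Longrightarrow> \<exists>e\<in>[K]\<^bsup>j\<^esup>. f e \<noteq> 1"
proof -
  define E where "E = [{..<N}]\<^bsup>j\<^esup>"
  define \<Omega> where "\<Omega> = PiE E (\<lambda>_. {..<m})"
  define bad where "bad n C' = {f \<in> \<Omega>. \<exists>K\<in>[{..<N}]\<^bsup>n\<^esup>. \<forall>e\<in>[K]\<^bsup>j\<^esup>. f e \<in> C'}" for n C'
  have sub: "{1..<m} \<subseteq> {..<m}" by auto
  have ne: "{..<m} \<noteq> {}" using assms(1) by (auto simp: lessThan_empty_iff)
  have fE: "finite E" by (simp add: E_def finite_imp_finite_nsets)
  have fO: "finite \<Omega>" "real (card \<Omega>) = real m ^ card E"
    using fE by (simp_all add: \<Omega>_def finite_PiE card_PiE)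
  have "real (card (bad n0 {0})) \<le> real N ^ n0 * (1 / real m) ^ (n0 choose j) * real m ^ card E"
    using card_monochromatic_colourings[of "{..<m}" "{0}" N j n0, OF _ _ ne] assms(1)
    by (simp add: bad_def \<Omega>_def E_def)
  moreover have "real (card (bad n1 {1..<m})) \<le> real N ^ n1 * (1 - 1 / real m) ^ (n1 choose j) * real m ^ card E"
    using card_monochromatic_colourings[of "{..<m}" "{1..<m}" N j n1, OF _ _ ne] assms(1) sub
    by (simp add: bad_def \<Omega>_def E_def of_nat_diff diff_divide_distrib)
  ultimately have "real (card (bad n0 {0}) + card (bad n1 {1..<m})) \<le>
      (real N ^ n0 / real m ^ (n0 choose j) + real N ^ n1 * (1 - 1 / real m) ^ (n1 choose j)) * real m ^ card E"
    by (simp add: algebra_simps power_divide)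
  also have "\<dots> < 1 * real m ^ card E"
    using less assms(1) by (intro mult_strict_right_mono) auto
  finally have "card (bad n0 {0} \<union> bad n1 {1..<m}) < card \<Omega>"
    unfolding mult_1 fO(2)[symmetric] of_nat_less_iff
    using card_Un_le[of "bad n0 {0}" "bad n1 {1..<m}"] by linarith
  moreover have "finite (bad n0 {0} \<union> bad n1 {1..<m})" using fO(1) by (simp add: bad_def)
  ultimately have "\<not> \<Omega> \<subseteq> bad n0 {0} \<union> bad n1 {1..<m}" by (meson card_mono not_le)
  then obtain f where f: "f \<in> \<Omega>" "f \<notin> bad n0 {0}" "f \<notin> bad n1 {1..<m}" by blast
  define g where "g e = (if f e = 0 then 0 else 1 :: nat)" for e
  have fm: "f e < m" if "e \<in> [K]\<^bsup>j\<^esup>" "K \<in> [{..<N}]\<^bsup>n\<^esup>" for e K n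
  proof -
    have "e \<in> E" using that by (auto simp: E_def nsets_def)
    then show ?thesis using f(1) by (auto simp: \<Omega>_def)
  qed
  show ?thesis
  proof (rule that[of g])
    show "\<exists>e\<in>[K]\<^bsup>j\<^esup>. g e \<noteq> 0" if "K \<in> [{..<N}]\<^bsup>n0\<^esup>" for K
      using f(1,2) that by (auto simp: bad_def g_def)
    show "\<exists>e\<in>[K]\<^bsup>j\<^esup>. g e \<noteq> 1" if K: "K \<in> [{..<N}]\<^bsup>n1\<^esup>" for K
    proof -
      obtain e where "e \<in> [K]\<^bsup>j\<^esup>" "f e \<notin> {1..<m}" using f(1,3) K by (auto simp: bad_def)
      then show ?thesis using fm[OF _ K, of e] by (intro bexI[of _ e]) (auto simp: g_def)
    qed
  qed (simp add: g_def)
qed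

section \<open>Base colourings\<close>

lemma shift_antimono_disjoint:
  assumes "shift_antimono j \<chi> vs" "subseq us (take i vs)" "subseq ws (drop i vs)"
    "length us = j" "length ws = j"
  shows "\<chi> ws \<le> \<chi> us"
proof -
  have "subseq (us @ ws) vs"
    using list_emb_append_mono[OF assms(2,3)] by simp
  then have "shift_antimono j \<chi> (us @ ws)" using assms(1) shift_antimono_subseq by blast
  from windows_antimono[OF this, of 0 j] show ?thesis using assms(4,5) by simp
qed

text \<open>If the first block of \<open>n\<close> contains a tuple below the top colour, everything
  behind the block stays below the top colour as well. Each block thus is monochromatic or removes a
  colour.\<close>

lemma monochromatic_block:
  assumes "shift_antimono j \<chi> vs" "Suc r * n \<le> length vs"
    and "\<And>us. subseq us vs \<Longrightarrow> length us = j \<Longrightarrow> \<chi> us < Suc r"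
  shows "\<exists>ws c. subseq ws vs \<and> length ws = n \<and> (\<forall>us. subseq us ws \<longrightarrow> length us = j \<longrightarrow> \<chi> us = c)"
  using assms
proof (induction r arbitrary: vs)
  case 0
  then show ?case
    by (intro exI[of _ "take n vs"] exI[of _ 0])
       (use subseq_order.order_trans prefix_imp_subseq[OF take_is_prefix] in fastforce)
next
  case (Suc r)
  have sub: "subseq (take n vs) vs" "subseq (drop n vs) vs"
    by (auto intro: prefix_imp_subseq suffix_imp_subseq take_is_prefix suffix_drop)
  show ?case
  proof (cases "\<exists>us. subseq us (take n vs) \<and> length us = j \<and> \<chi> us < Suc r")
    case True
    then obtain us where us: "subseq us (take n vs)" "length us = j" "\<chi> us < Suc r" by blast
    have "\<exists>ws c. subseq ws (drop n vs) \<and> length ws = n \<and> (\<forall>us. subseq us ws \<longrightarrow> length us = j \<longrightarrow> \<chi> us = c)"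
    proof (rule Suc.IH)
      show "shift_antimono j \<chi> (drop n vs)" using Suc.prems(1) sub shift_antimono_subseq by blast
      show "Suc r * n \<le> length (drop n vs)" using Suc.prems(2) by simp
      show "\<chi> ws < Suc r" if "subseq ws (drop n vs)" "length ws = j" for ws
        using shift_antimono_disjoint[OF Suc.prems(1) us(1) that(1) us(2) that(2)] us(3) by simp
    qed
    then show ?thesis using sub subseq_order.order_trans by blast
  next
    case False
    then have "\<chi> us = Suc r" if "subseq us (take n vs)" "length us = j" for us
      using that Suc.prems(3)[of us] sub subseq_order.order_trans by (metis less_SucE)
    then show ?thesis using sub Suc.prems(2)
      by (intro exI[of _ "take n vs"] exI[of _ "Suc r"]) auto
  qed
qed

lemma avoidable_of_no_monochromatic:
  assumes "\<And>us. \<chi> us < q" "0 < q"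
    and "\<And>vs c. sorted_wrt (<) vs \<Longrightarrow> set vs \<subseteq> {..<N} \<Longrightarrow> length vs = n \<Longrightarrow>
      \<exists>us. subseq us vs \<and> length us = j \<and> \<chi> us \<noteq> c"
  shows "avoidable q j (q * n) N"
  unfolding avoidable_def
proof (intro exI[of _ \<chi>] conjI allI impI notI)
  fix vs assume vs: "sorted_wrt (<) vs" "set vs \<subseteq> {..<N}" "length vs = q * n" "shift_antimono j \<chi> vs"
  obtain r where r: "q = Suc r" using assms(2) by (cases q) auto
  obtain ws c where ws: "subseq ws vs" "length ws = n"
    "\<And>us. subseq us ws \<Longrightarrow> length us = j \<Longrightarrow> \<chi> us = c"
    using monochromatic_block[OF vs(4), of r n] vs(3) assms(1) r by auto
  then show False
    using assms(3)[of ws c] vs(1,2) sorted_wrt_subseq set_subseq by blast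
qed (rule assms(1))

lemma list_of_nset:
  assumes "sorted_wrt (<) (vs :: nat list)" "e \<in> [set vs]\<^bsup>j\<^esup>"
  obtains us where "subseq us vs" "length us = j" "set us = e" "sorted_wrt (<) us"
proof (rule that[of "sorted_list_of_set e"])
  have e: "finite e" "e \<subseteq> set vs" "card e = j" using assms(2) by (auto simp: nsets_def)
  show "subseq (sorted_list_of_set e) vs"
    using e assms(1) by (intro sorted_subset_imp_subseq) (auto simp: strict_sorted_iff)
qed (use assms in \<open>auto simp: nsets_def\<close>)

lemma set_in_nsets:
  assumes "sorted_wrt (<) (vs :: nat list)" "set vs \<subseteq> {..<N}" "length vs = n"
  shows "set vs \<in> [{..<N}]\<^bsup>n\<^esup>"
  using assms by (auto simp: nsets_def strict_sorted_iff distinct_card)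

lemma avoidable_random:
  assumes "a * n + 1 < n choose j"
  shows "avoidable 2 j (2 * n) (2 ^ a)"
proof -
  have "real (2 ^ a) ^ n / real 2 ^ (n choose j) + real (2 ^ a) ^ n * (1 - 1 / real 2) ^ (n choose j)
      = 2 ^ (a * n + 1) / 2 ^ (n choose j)"
    by (simp add: power_mult power_one_over)
  also have "\<dots> < (1::real)"
    using power_strict_increasing[OF assms, of "2::real"] by (simp only: divide_less_eq_1_pos zero_less_power zero_less_numeral)
  finally obtain f :: "nat set \<Rightarrow> nat" where f: "\<And>e. f e < 2"
    "\<And>K. K \<in> [{..<2 ^ a}]\<^bsup>n\<^esup> \<Longrightarrow> \<exists>e\<in>[K]\<^bsup>j\<^esup>. f e \<noteq> 0"
    "\<And>K. K \<in> [{..<2 ^ a}]\<^bsup>n\<^esup> \<Longrightarrow> \<exists>e\<in>[K]\<^bsup>j\<^esup>. f e \<noteq> 1"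
    using random_two_colouring[of 2 "2 ^ a" n j n] by auto
  show ?thesis
  proof (rule avoidable_of_no_monochromatic[of "\<lambda>us. f (set us)"])
    fix vs c assume vs: "sorted_wrt (<) vs" "set vs \<subseteq> {..<2 ^ a :: nat}" "length vs = n"
    have "\<exists>e\<in>[set vs]\<^bsup>j\<^esup>. f e \<noteq> c"
    proof (cases "c = 0")
      case False
      obtain e where "e \<in> [set vs]\<^bsup>j\<^esup>" "f e \<noteq> 1" using f(3)[OF set_in_nsets[OF vs]] by blast
      then show ?thesis using False f(1)[of e] by (intro bexI[of _ e]) auto
    qed (use f(2)[OF set_in_nsets[OF vs]] in blast)
    then show "\<exists>us. subseq us vs \<and> length us = j \<and> f (set us) \<noteq> c"
      using list_of_nset[OF vs(1)] by metis
  qed (use f(1) in auto)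
qed

text \<open>Rising pairs use colours 0 and 1, falling pairs 2 and 3. In an antimonotone set a rise
  is therefore never followed by a fall, and one half of the deltas is a monotone run. No turn
  colours are needed, and the cost is a factor 2 only.\<close>

lemma avoidable_four_colours:
  assumes "avoidable 2 2 n N" "1 \<le> n"
  shows "avoidable 4 3 (2 * n) (2 ^ N)"
proof -
  obtain \<chi> where \<chi>: "\<And>us. \<chi> us < 2"
    "\<And>vs. sorted_wrt (<) vs \<Longrightarrow> set vs \<subseteq> {..<N} \<Longrightarrow> length vs = n \<Longrightarrow> \<not> shift_antimono 2 \<chi> vs"
    using assms(1) unfolding avoidable_def by blast
  define F where "F D = (if sorted_wrt (<) D then \<chi> D else 3 - \<chi> (rev D))" for D
  have F: "F D < 4" for D using \<chi>(1)[of D] by (auto simp: F_def)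
  have "\<not> shift_antimono 3 (\<lambda>us. F (deltas us)) vs"
    if vs: "sorted_wrt (<) vs" "set vs \<subseteq> {..<2 ^ N}" "length vs = 2 * n" for vs
  proof
    assume "shift_antimono 3 (\<lambda>us. F (deltas us)) vs"
    then have anti: "shift_antimono (Suc 2) (\<lambda>us. F (deltas us)) vs" by (simp add: eval_nat_numeral)
    define D where "D = deltas vs"
    have lD: "length D = 2 * n - 1" by (simp add: D_def vs)
    have up: "up D i'" if i: "up D i" "i \<le> i'" "Suc i' < length D" for i i'
    proof -
      have W: "take 2 (drop k D) = [D ! k, D ! Suc k]" if "Suc k < length D" for k
        using that by (simp add: numeral_2_eq_2 take_Suc_conv_app_nth flip: Cons_nth_drop_Suc)
      have "F (take 2 (drop i' D)) \<le> F (take 2 (drop i D))"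
        unfolding D_def by (rule shift_antimono_windows[OF anti]) (use i in \<open>auto simp: D_def\<close>)
      moreover have "F (take 2 (drop i D)) < 2"
        using i W[of i] \<chi>(1) by (simp add: F_def up_def)
      ultimately show ?thesis
        using W[of i'] i \<chi>(1)[of "rev [D ! i', D ! Suc i']"] by (auto simp: F_def up_def split: if_splits)
    qed
    have no_run: False if "a + n \<le> length D" "monotone_list (take n (drop a D))" for a
    proof (rule no_long_run[where \<chi> = \<chi> and c = 3 and F = F and j = 2 and a = a, OF _ \<chi>(2) vs(1,2) anti])
      show "\<chi> us \<le> 3" for us using \<chi>(1)[of us] by simp
      show "F D = 3 - \<chi> (rev D)" if "sorted_wrt (>) D" "length D = 2" for D
        using not_increasing_and_decreasing[of D] that by (auto simp: F_def)
    qed (use that assms(2) in \<open>auto simp: F_def D_def\<close>)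
    show False
    proof (cases "\<exists>t. Suc t < n \<and> up D t")
      case True
      then obtain t where t: "Suc t < n" "up D t" by blast
      have "monotone_list (take n (drop (n - 1) D))"
        unfolding D_def by (rule monotone_window_up[OF vs(1)])
          (use up[OF t(2)] t(1) lD in \<open>auto simp: D_def\<close>)
      moreover have "n - 1 + n \<le> length D" using lD assms(2) by linarith
      ultimately show False using no_run by blast
    next
      case False
      have "monotone_list (take n (drop 0 D))"
        unfolding D_def by (rule monotone_window_up[OF vs(1)])
          (use False lD assms(2) in \<open>auto simp: D_def\<close>)
      moreover have "0 + n \<le> length D" using lD assms(2) by linarith
      ultimately show False using no_run by blast
    qed
  qed
  then show ?thesis
    unfolding avoidable_def using F by (intro exI[of _ "\<lambda>us. F (deltas us)"]) simp
qed

text \<open>Every set of more than \<open>2 ^ t\<close> vertices spans a binary tree one of whose root-to-leaf paths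
  has more than \<open>t\<close> branchings.\<close>

lemma nested_deltas:
  fixes V :: "nat set" and f :: "nat set \<Rightarrow> nat"
  assumes "finite V" "2 ^ t < card V"
    and "\<And>x y z. x \<in> V \<Longrightarrow> y \<in> V \<Longrightarrow> z \<in> V \<Longrightarrow> x < y \<Longrightarrow> y < z \<Longrightarrow> f {delta x y, delta y z} = c"
  shows "\<exists>K. finite K \<and> card K = Suc t \<and> K \<subseteq> {delta x y |x y. x \<in> V \<and> y \<in> V \<and> x < y} \<and> (\<forall>e\<in>[K]\<^bsup>2\<^esup>. f e = c)"
  using assms
proof (induction t arbitrary: V)
  case 0
  then have "card V \<ge> 2" by simp
  then obtain x y where "x \<in> V" "y \<in> V" "x \<noteq> y"
    using card_le_Suc0_iff_eq[OF 0(1)] by fastforce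
  then obtain x y where "x \<in> V" "y \<in> V" "x < y" by (metis linorder_neqE_nat)
  then show ?case
    by (intro exI[of _ "{delta x y}"]) (auto simp: nsets_def card_2_iff doubleton_eq_iff)
next
  case (Suc t)
  define a b where "a = Min V" and "b = Max V"
  have ne: "V \<noteq> {}" using Suc.prems(2) by auto
  have ab: "a \<in> V" "b \<in> V" "\<And>x. x \<in> V \<Longrightarrow> a \<le> x \<and> x \<le> b"
    using Suc.prems(1) ne by (simp_all add: a_def b_def)
  have "a \<noteq> b"
  proof
    assume "a = b"
    then have "V \<subseteq> {a}" using ab by force
    then have "card V \<le> 1" using card_mono[of "{a}" V] by simp
    then show False using Suc.prems(2) less_exp[of "Suc t"] by linarith
  qed
  then have "a < b" using ab by force
  define m where "m = delta a b"
  define L where "L = {x \<in> V. x = a \<or> delta a x < m}"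
  define R where "R = V - L"
  have bR: "b \<in> R" using \<open>a < b\<close> ab by (auto simp: R_def L_def m_def)
  have aL: "a \<in> L" using ab by (simp add: L_def)
  have le_m: "delta a x \<le> m" if "x \<in> V" "x \<noteq> a" for x
    using delta_max[of a x b] ab(3)[OF that(1)] that(2) unfolding m_def
    by (cases "x = b") auto
  have R: "delta a x = m" "a < x" if "x \<in> R" for x
    using that le_m[of x] ab(3)[of x] by (auto simp: R_def L_def)
  have LL: "delta x y < m" if "x \<in> L" "y \<in> L" "x < y" for x y
    using that delta_max[of a x y] ab(3)[of x] by (cases "x = a") (auto simp: L_def)
  have LR: "x < z \<and> delta x z = m" if "x \<in> L" "z \<in> R" for x z
  proof (cases "x = a")
    case False
    have "delta a x < m" "a < x" using that(1) False ab(3)[of x] by (auto simp: L_def)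
    moreover have "x \<noteq> z" using that by (auto simp: R_def)
    moreover have "\<not> z < x"
    proof
      assume "z < x"
      then have "delta a x \<ge> m" using delta_max[of a z x] R[OF that(2)] by simp
      then show False using \<open>delta a x < m\<close> by simp
    qed
    ultimately show ?thesis using delta_max[of a x z] R[OF that(2)] by auto
  qed (use R that in auto)
  have RR: "delta y z < m" if "y \<in> R" "z \<in> R" "y < z" for y z
    using delta_neq[of a y z] delta_max[of a y z] R[OF that(1)] R[OF that(2)] that(3) by auto
  have fin: "finite L" "finite R" using Suc.prems(1) by (auto simp: L_def R_def)
  have "card V = card L + card R"
    using fin card_Un_disjoint[of L R] by (simp add: R_def L_def Un_absorb1 subset_iff)
  then have "2 ^ t < card L \<or> 2 ^ t < card R" using Suc.prems(2) by auto
  then obtain S where S: "S = L \<or> S = R" "2 ^ t < card S" by blast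
  have SV: "S \<subseteq> V" "finite S" using S(1) fin by (auto simp: L_def R_def)
  have "\<exists>K. finite K \<and> card K = Suc t \<and> K \<subseteq> {delta x y |x y. x \<in> S \<and> y \<in> S \<and> x < y} \<and> (\<forall>e\<in>[K]\<^bsup>2\<^esup>. f e = c)"
    by (rule Suc.IH[OF SV(2) S(2)]) (use Suc.prems(3) SV(1) in blast)
  then obtain K where K: "finite K" "card K = Suc t" "K \<subseteq> {delta x y |x y. x \<in> S \<and> y \<in> S \<and> x < y}"
    "\<And>e. e \<in> [K]\<^bsup>2\<^esup> \<Longrightarrow> f e = c"
    by blast
  \<comment> \<open>To realise the pair of \<open>k\<close> and the top branching \<open>m\<close>,
    an edge inside the left part is continued by the maximum \<open>b\<close>, one inside the right
    part is preceded by the minimum \<open>a\<close>.\<close>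
  have less: "k < m \<and> f {k, m} = c" if k: "k \<in> K" for k
  proof -
    obtain x y where xy: "k = delta x y" "x \<in> S" "y \<in> S" "x < y" using K(3) k by blast
    show ?thesis
    proof (cases "S = L")
      case True
      then have "y < b" "delta y b = m" using LR[of y b] xy bR by auto
      then show ?thesis using Suc.prems(3)[of x y b] xy SV ab(2) LL[of x y] True by auto
    next
      case False
      then have "S = R" using S(1) by blast
      then have "a < x" "delta a x = m" using R[of x] xy by auto
      then show ?thesis
        using Suc.prems(3)[of a x y] xy SV ab(1) RR[of x y] \<open>S = R\<close> by (auto simp: insert_commute)
    qed
  qed
  show ?case
  proof (intro exI[of _ "insert m K"] conjI ballI)
    show "card (insert m K) = Suc (Suc t)" using K(1,2) less by (subst card_insert_disjoint) auto
    have "K \<subseteq> {delta x y |x y. x \<in> V \<and> y \<in> V \<and> x < y}" using K(3) SV(1) by blast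
    then show "insert m K \<subseteq> {delta x y |x y. x \<in> V \<and> y \<in> V \<and> x < y}"
      using ab(1,2) \<open>a < b\<close> unfolding m_def by blast
    show "f e = c" if "e \<in> [insert m K]\<^bsup>2\<^esup>" for e
    proof (cases "m \<in> e")
      case True
      have "card e = 2" using that by (simp add: nsets_def)
      then obtain k where "e = {k, m}" "k \<noteq> m" using True by (auto simp: card_2_iff insert_commute)
      moreover have "e \<subseteq> insert m K" using that by (simp add: nsets_def)
      ultimately show ?thesis using less[of k] by auto
    next
      case False
      then show ?thesis using that K(4)[of e] by (auto simp: nsets_def)
    qed
  qed (use K in auto)
qed

text \<open>Edge colour 0 has density \<open>2 ^ (- t)\<close> and becomes triple colour 1; the
  other edges split by direction into 0 and 2. A set monochromatic in 1 needs only a clique of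
  logarithmic size in the rare colour, by \<open>nested_deltas\<close>. One monochromatic in 0 or 2
  has monotone deltas and yields a clique of nearly its own size in the common colour.\<close>

lemma avoidable_three_colours:
  assumes "2 \<le> t"
  shows "avoidable 3 3 (3 * (2 ^ (3 * t) + 2)) (2 ^ 2 ^ (t\<^sup>2 div 4))"
proof -
  \<comment> \<open>The rare clique of size \<open>t + 1\<close> is avoided for \<open>a\<close> of
    order \<open>t\<^sup>2\<close>; against the common colour a clique size exponential in
    \<open>t\<close> is affordable. As \<open>n\<close> is about \<open>8 ^ t\<close>, the exponent
    \<open>a\<close> is of order \<open>log\<^sup>2 n\<close>.\<close>
  define a n m :: nat where "a = t\<^sup>2 div 4" and "n = 2 ^ (3 * t) + 1" and "m = 2 ^ t"
  have "real (2 ^ a) ^ Suc t / real m ^ (Suc t choose 2) \<le> 1 / 2"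
  proof -
    have "4 * a \<le> t * t" by (simp add: a_def power2_eq_square)
    then have "4 * a * Suc t \<le> t * t * Suc t" by (rule mult_le_mono1)
    moreover have "2 * 2 * 3 \<le> t * t * Suc t" using assms by (intro mult_le_mono) auto
    moreover have "2 * (Suc t choose 2) = t * Suc t"
      by (simp add: choose_two)
    then have "2 * (t * (Suc t choose 2)) = t * t * Suc t" by (simp add: algebra_simps)
    ultimately have le: "a * Suc t + 1 \<le> t * (Suc t choose 2)" by linarith
    have "real (2 ^ a) ^ Suc t = 2 ^ (a * Suc t)" by (simp only: of_nat_power of_nat_numeral power_mult)
    then have "real (2 ^ a) ^ Suc t * 2 = 2 ^ (a * Suc t + 1)" by (simp only: power_add power_one_right)
    also have "\<dots> \<le> (2::real) ^ (t * (Suc t choose 2))" by (rule power_increasing[OF le]) simp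
    also have "\<dots> = real m ^ (Suc t choose 2)" by (simp add: m_def power_mult)
    finally show ?thesis by (simp add: m_def field_simps)
  qed
  moreover have "real (2 ^ a) ^ n * (1 - 1 / real m) ^ (n choose 2) < 1 / 2"
  proof -
    have half: "(1 - 1 / real m) ^ m \<le> 1 / 2"
    proof -
      have m2: "2 \<le> m" using assms power_increasing[of 1 t "2::nat"] by (simp add: m_def)
      have "1 - 1 / real m \<le> exp (- (1 / real m))" using exp_ge_add_one_self[of "- (1 / real m)"] by simp
      then have "(1 - 1 / real m) ^ m \<le> exp (- (1 / real m)) ^ m"
        using m2 by (intro power_mono) auto
      also have "\<dots> = exp (- 1)" using m2 by (simp flip: exp_of_nat_mult)
      also have "\<dots> \<le> 1 / 2" using exp_ge_add_one_self[of 1] by (simp add: exp_minus field_simps)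
      finally show ?thesis .
    qed
    \<comment> \<open>Chosen so that \<open>n choose 2 = m * x\<close>; each group of
      \<open>m\<close> edges contributes a factor of at most one half.\<close>
    define x where "x = n * 2 ^ (2 * t - 1)"
    have "even (n * (n - 1))" by (cases "even n") auto
    then have "2 * (n choose 2) = n * (n - 1)" by (simp only: choose_two dvd_mult_div_cancel)
    also have "\<dots> = n * (2 * (2 ^ t * 2 ^ (2 * t - 1)))"
      using assms by (simp add: n_def flip: power_add power_Suc)
    finally have c: "n choose 2 = m * x" by (simp add: m_def x_def)
    have "t * t < 2 ^ t * 2 ^ t" using less_exp[of t] by (intro mult_strict_mono) auto
    also have "\<dots> = 2 * 2 ^ (2 * t - 1)"
      using assms by (simp flip: power_add power_Suc)
    finally have "t * t < 2 * 2 ^ (2 * t - 1)" .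
    moreover have "4 * a \<le> t * t" by (simp add: a_def power2_eq_square)
    moreover have "2 * 2 \<le> t * t" using assms by (intro mult_le_mono) auto
    ultimately have "a + 1 \<le> 2 ^ (2 * t - 1)" by linarith
    then have "n * (a + 1) \<le> x" unfolding x_def by (rule mult_le_mono2)
    moreover have "2 \<le> n" by (simp add: n_def)
    ultimately have le: "a * n + 2 \<le> x" by (simp add: algebra_simps)
    have "real (2 ^ a) ^ n * (1 - 1 / real m) ^ (n choose 2) \<le> 2 ^ (a * n) * (1 / 2) ^ x"
      unfolding c power_mult using half
      by (intro mult_mono power_mono) (simp_all add: m_def)
    also have "\<dots> \<le> 2 ^ (a * n) * (1 / 2) ^ (a * n + 2)"
      by (intro mult_left_mono power_decreasing[OF le]) simp_all
    also have "\<dots> = 1 / (4::real)" by (simp add: power_add power_one_over)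
    finally show ?thesis by simp
  qed
  ultimately have "real (2 ^ a) ^ Suc t / real m ^ (Suc t choose 2) + real (2 ^ a) ^ n * (1 - 1 / real m) ^ (n choose 2) < 1"
    by linarith
  moreover have "2 \<le> m" using assms power_increasing[of 1 t "2::nat"] by (simp add: m_def)
  ultimately obtain f :: "nat set \<Rightarrow> nat" where f: "\<And>e. f e < 2"
    "\<And>K. K \<in> [{..<2 ^ a}]\<^bsup>Suc t\<^esup> \<Longrightarrow> \<exists>e\<in>[K]\<^bsup>2\<^esup>. f e \<noteq> 0"
    "\<And>K. K \<in> [{..<2 ^ a}]\<^bsup>n\<^esup> \<Longrightarrow> \<exists>e\<in>[K]\<^bsup>2\<^esup>. f e \<noteq> 1"
    using random_two_colouring[of m "2 ^ a" "Suc t" 2 n] by metis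
  define F :: "nat list \<Rightarrow> nat" where
    "F D = (if f (set D) = 0 then 1 else if sorted_wrt (<) D then 0 else 2)" for D
  have "avoidable 3 3 (3 * Suc n) (2 ^ 2 ^ a)"
  proof (rule avoidable_of_no_monochromatic[of "\<lambda>us. F (deltas us)"])
    fix vs c assume vs: "sorted_wrt (<) vs" "set vs \<subseteq> {..<2 ^ 2 ^ a :: nat}" "length vs = Suc n"
    define D where "D = deltas vs"
    have lD: "length D = n" using vs(3) by (simp add: D_def)
    show "\<exists>us. subseq us vs \<and> length us = 3 \<and> F (deltas us) \<noteq> c"
    proof (rule ccontr)
      assume "\<not> ?thesis"
      then have mono: "F (deltas us) = c" if "subseq us vs" "length us = 3" for us using that by blast
      have window: "F [D ! i, D ! Suc i] = c" if "Suc i < n" for i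
      proof -
        have "deltas (take 3 (drop i vs)) = take 2 (drop i D)"
          using deltas_window[of 2 i vs] by (simp add: D_def eval_nat_numeral)
        also have "\<dots> = [D ! i, D ! Suc i]"
          using that lD by (simp add: numeral_2_eq_2 take_Suc_conv_app_nth flip: Cons_nth_drop_Suc)
        finally show ?thesis
          using mono[OF subseq_window, of 3 i] that vs(3) by simp
      qed
      show False
      proof (cases "c = 1")
        case True
        have "f {delta x y, delta y z} = 0"
          if "x \<in> set vs" "y \<in> set vs" "z \<in> set vs" "x < y" "y < z" for x y z
        proof -
          have "subseq [x, y, z] vs"
            using that vs(1) by (intro sorted_subset_imp_subseq) (auto simp: strict_sorted_iff)
          then have "F [delta x y, delta y z] = 1" using mono[of "[x, y, z]"] True by simp
          then show ?thesis by (auto simp: F_def split: if_splits)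
        qed
        moreover have "2 ^ t < card (set vs)"
        proof -
          have "(2::nat) ^ t \<le> 2 ^ (3 * t)" by (intro power_increasing) auto
          moreover have "card (set vs) = Suc n" using vs(1,3) by (simp add: strict_sorted_iff distinct_card)
          ultimately show ?thesis unfolding n_def by linarith
        qed
        ultimately obtain K where K: "finite K" "card K = Suc t"
          "K \<subseteq> {delta x y |x y. x \<in> set vs \<and> y \<in> set vs \<and> x < y}" "\<forall>e\<in>[K]\<^bsup>2\<^esup>. f e = 0"
          using nested_deltas[of "set vs" t f 0] by auto
        have "delta x y < 2 ^ a" if "x < y" "y \<in> set vs" for x y
          using that vs(2) by (intro delta_less) auto
        then have "K \<subseteq> {..<2 ^ a}" using K(3) by blast
        then have "K \<in> [{..<2 ^ a}]\<^bsup>Suc t\<^esup>" using K(1,2) by (simp add: nsets_def)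
        from f(2)[OF this] show False using K(4) by auto
      next
        case False
        have "sorted_wrt (<) [D ! i, D ! Suc i] \<longleftrightarrow> c = 0" if "Suc i < n" for i
          using window[OF that] False by (auto simp: F_def split: if_splits)
        then have "monotone_list (take n (drop 0 D))"
          unfolding D_def using lD
          by (intro monotone_window[OF vs(1)]) (simp_all add: D_def)
        then have "monotone_list (deltas vs)" using lD by (simp add: D_def)
        have f1: "f e = 1" if e: "e \<in> [set D]\<^bsup>2\<^esup>" for e
        proof -
          define D' where "D' = (if sorted_wrt (<) D then D else rev D)"
          have sD': "sorted_wrt (<) D'"
            using \<open>monotone_list (deltas vs)\<close> by (auto simp: D'_def D_def monotone_list_def sorted_wrt_rev)
          have "e \<in> [set D']\<^bsup>2\<^esup>" using e by (simp add: D'_def)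
          then obtain es' where es': "subseq es' D'" "length es' = 2" "set es' = e"
            using list_of_nset[OF sD'] by metis
          obtain es where es: "subseq es D" "length es = 2" "set es = e"
          proof (cases "sorted_wrt (<) D")
            case True
            then show ?thesis using that es' by (simp add: D'_def)
          next
            case False
            then have "subseq (rev es') D" using subseq_rev[OF es'(1)] by (simp add: D'_def)
            then show ?thesis using that[of "rev es'"] es' by simp
          qed
          have "vs \<noteq> []" "es \<noteq> []" using vs(3) es(2) by auto
          then obtain us where us: "subseq us vs" "us \<noteq> []" "deltas us = es"
            using select_monotone[of vs es] vs(1) \<open>monotone_list (deltas vs)\<close> es(1) unfolding D_def by metis
          then have "length us = 3" using es(2) by (cases us) auto
          then have "F es = c" using mono us by metis
          moreover have "F es = 1" if "f e = 0" using that es(3) by (simp add: F_def)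
          ultimately have "f e \<noteq> 0" using False by blast
          then show ?thesis using f(1)[of e] by simp
        qed
        define K where "K = set D"
        have "distinct D" using \<open>monotone_list (deltas vs)\<close>
          unfolding monotone_list_def D_def
          by (metis distinct_rev sorted_wrt_rev strict_sorted_iff rev_rev_ident)
        then have "card K = n" using lD by (simp add: K_def distinct_card)
        moreover have "K \<subseteq> {..<2 ^ a}" using set_deltas[OF vs(1,2)] by (simp add: K_def D_def)
        ultimately have "K \<in> [{..<2 ^ a}]\<^bsup>n\<^esup>" by (simp add: nsets_def K_def)
        then show False using f(3) f1 by (auto simp: K_def)
      qed
    qed
  qed (simp_all add: F_def)
  then show ?thesis by (simp add: n_def a_def)
qed

section \<open>Tower bounds\<close>

lemma twr_Suc: "1 \<le> h \<Longrightarrow> twr (Suc h) x = 2 powr twr h x"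
  by (cases h) auto

lemma twr_mono: "x \<le> y \<Longrightarrow> twr h x \<le> twr h y"
  by (induction h x rule: twr.induct) auto

lemma isCont_twr: "isCont (twr h) x"
proof -
  have "continuous_on UNIV (twr h)"
  proof (induction h rule: nat_less_induct)
    case (1 h)
    consider "h = 0" | "h = 1" | i where "h = Suc (Suc i)"
      by (cases h; cases "h - 1") auto
    then show ?case
    proof cases
      case (3 i)
      then have "continuous_on UNIV (\<lambda>x. 2 powr twr (Suc i) x)"
        using 1 by (intro continuous_intros) auto
      then show ?thesis using 3 by (auto cong: continuous_on_cong)
    qed (auto cong: continuous_on_cong)
  qed
  then show ?thesis by (simp add: continuous_on_eq_continuous_at)
qed

text \<open>Hides the vertex number: a step changes \<open>n\<close> and the height \<open>h\<close>
  but never the argument \<open>x\<close>, so constants enter only when \<open>g n\<close> is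
  compared with \<open>g m\<close>.\<close>

definition reaches :: "nat \<Rightarrow> nat \<Rightarrow> nat \<Rightarrow> nat \<Rightarrow> real \<Rightarrow> bool" where
  "reaches q j n h x \<longleftrightarrow> (\<exists>N. avoidable q j n N \<and> twr h x \<le> real N)"

lemma reachesI: "avoidable q j n N \<Longrightarrow> twr h x \<le> real N \<Longrightarrow> reaches q j n h x"
  unfolding reaches_def by blast

lemma reaches_mono:
  "reaches q j n h x \<Longrightarrow> n \<le> n' \<Longrightarrow> x' \<le> x \<Longrightarrow> reaches q j n' h x'"
  unfolding reaches_def using avoidable_mono twr_mono by (meson order.refl order_trans)

lemma twr_Suc_le: "1 \<le> h \<Longrightarrow> twr h x \<le> real N \<Longrightarrow> twr (Suc h) x \<le> real (2 ^ N)"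
proof -
  assume "1 \<le> h" "twr h x \<le> real N"
  then have "twr (Suc h) x \<le> 2 powr real N" by (simp add: twr_Suc)
  then show ?thesis by (simp add: powr_realpow)
qed

lemma reaches_step_lossy:
  assumes "reaches q j n h x" "3 \<le> j" "2 \<le> q" "1 \<le> n" "1 \<le> h"
  shows "reaches q (Suc j) (3 * n + j) (Suc h) x"
  using assms avoidable_step_lossy twr_Suc_le unfolding reaches_def by blast

lemma reaches_step_tight:
  assumes "reaches q j n h x" "2 \<le> q" "6 \<le> j" "2 * j + 3 \<le> n" "1 \<le> h"
  shows "reaches q (Suc j) (n + 3) (Suc h) x" "reaches q (Suc (Suc j)) (n + 5) (Suc (Suc h)) x"
proof -
  obtain N where N: "avoidable q j n N" "twr h x \<le> real N" using assms(1) unfolding reaches_def by blast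
  have "twr (Suc h) x \<le> real (2 ^ N)" using twr_Suc_le N(2) assms(5) by blast
  moreover from twr_Suc_le[OF _ this] have "twr (Suc (Suc h)) x \<le> real (2 ^ 2 ^ N)" by simp
  ultimately show "reaches q (Suc j) (n + 3) (Suc h) x" "reaches q (Suc (Suc j)) (n + 5) (Suc (Suc h)) x"
    using avoidable_step_tight[OF N(1) assms(2-4)] unfolding reaches_def by blast+
qed

lemma reaches_iterate:
  assumes "reaches q 6 n h x" "2 \<le> q" "15 \<le> n" "1 \<le> h"
  shows "reaches q (6 + 2 * i) (n + 5 * i) (h + 2 * i) x"
proof (induction i)
  case (Suc i)
  then show ?case using reaches_step_tight(2)[OF Suc] assms by (simp add: algebra_simps)
qed (use assms in simp)

lemma reaches_path_ramsey:
  "reaches q j n h x \<Longrightarrow> 1 \<le> j \<Longrightarrow> twr h x \<le> real (path_ramsey (Suc j) (j + q) n)"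
  unfolding reaches_def using path_ramsey_greater by (meson less_imp_le of_nat_le_iff order_trans)

text \<open>The smallest admissible size for \<open>k = Suc j\<close> is \<open>3 * j + 4\<close>.
  Beating the tower strictly at 0 leaves, by continuity, room for a positive argument. Up to
  \<open>j = 5\<close> having fewer vertices than the required size is enough, as
  \<open>16 < 18\<close>; for \<open>j = 6\<close> the value 65536 calls for a random
  colouring.\<close>

lemma avoidable_small:
  assumes "j \<in> {3..6}" "d \<le> 1" "2 \<le> q"
  shows "\<exists>N. avoidable q j (3 * j + 4) N \<and> twr (j - d) 0 < real N"
proof -
  have t: "twr 1 0 = 0" "twr 2 0 = 1" "twr 3 0 = 2" "twr 4 0 = 4" "twr 5 0 = 16" "twr 6 0 = 65536"
  proof -
    show t: "twr 1 0 = 0" by simp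
    show t: "twr 2 0 = 1" using twr_Suc[of 1 0] t by (simp add: eval_nat_numeral)
    show t: "twr 3 0 = 2" using twr_Suc[of 2 0] t by (simp add: eval_nat_numeral)
    show t: "twr 4 0 = 4" using twr_Suc[of 3 0] t by simp
    show t: "twr 5 0 = 16" using twr_Suc[of 4 0] t by simp
    show t: "twr 6 0 = 65536" using twr_Suc[of 5 0] t by simp
  qed
  show ?thesis
  proof (cases "j = 6")
    case True
    \<comment> \<open>\<open>avoidable_random\<close> doubles the size 11 to the required 22, and
      \<open>2 ^ 17\<close> exceeds \<open>twr 6 0 = 2 ^ 16\<close>.\<close>
    have "17 * 11 + 1 < (11 choose 6 :: nat)" by (simp add: binomial_fact' fact_numeral)
    then have "avoidable 2 6 22 (2 ^ 17)" using avoidable_random[of 17 11 6] by simp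
    then have "avoidable q 6 22 (2 ^ 17)" using assms(3) avoidable_colours_mono by blast
    moreover have "d = 0 \<or> d = 1" using assms(2) by auto
    ultimately show ?thesis using True t by (intro exI[of _ "2 ^ 17"]) auto
  next
    case False
    have "avoidable q j (3 * j + 4) (3 * j + 3)" using assms(3) by (intro avoidable_trivial) auto
    moreover have "j = 3 \<or> j = 4 \<or> j = 5" "d = 0 \<or> d = 1" using assms False by auto
    ultimately show ?thesis using t by (intro exI[of _ "3 * j + 3"]) auto
  qed
qed

text \<open>The hypothesis on \<open>g\<close> allows to replace \<open>n\<close> by any \<open>m \<ge> n / 6\<close>: each lossy step divides
  \<open>n\<close> by at most \<open>6\<close>, and so do all tight steps together, because \<open>n > 3 k\<close>.\<close>

lemma path_ramsey_tower:
  fixes g :: "nat \<Rightarrow> real"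
  assumes q: "2 \<le> Suc r" and d: "d \<le> 1" and g0: "\<And>n. 0 \<le> g n"
    and C: "1 \<le> C" "\<And>m n. 22 \<le> m \<Longrightarrow> n \<le> 6 * m \<Longrightarrow> g n \<le> C * g m"
    and base: "0 < rate" "\<And>n. start \<le> n \<Longrightarrow> reaches (Suc r) 3 n (3 - d) (rate * g n)"
  shows "\<exists>c>0. \<forall>k n. 4 \<le> k \<longrightarrow> 3 * k < n \<longrightarrow>
    twr (k - Suc d) (c * g n) \<le> real (path_ramsey k (k + r) n)"
proof -
  have large: "\<exists>c start. 0 < c \<and> (\<forall>n\<ge>start. reaches (Suc r) (3 + i) n (3 + i - d) (c * g n))" if "i \<le> 3" for i
    using that
  proof (induction i)
    case 0
    then show ?case using base by auto
  next
    case (Suc i)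
    then obtain c start where c: "0 < c" "\<And>n. start \<le> n \<Longrightarrow> reaches (Suc r) (3 + i) n (3 + i - d) (c * g n)" by auto
    have "reaches (Suc r) (3 + Suc i) n (3 + Suc i - d) (c / C * g n)" if n: "3 * start + 80 \<le> n" for n
    proof -
      define m where "m = (n - (3 + i)) div 3"
      have m: "start \<le> m" "22 \<le> m" "n \<le> 6 * m" "3 * m + (3 + i) \<le> n"
        using n Suc.prems by (auto simp: m_def)
      have "reaches (Suc r) (Suc (3 + i)) (3 * m + (3 + i)) (Suc (3 + i - d)) (c * g m)"
        using c(2)[OF m(1)] q m(2) d by (intro reaches_step_lossy) auto
      moreover have "c / C * g n \<le> c * g m"
        using C(2)[OF m(2,3)] C(1) c(1) by (simp add: field_simps)
      moreover have "Suc (3 + i - d) = 3 + Suc i - d" using d by simp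
      ultimately show ?thesis using reaches_mono m(4) by (metis add_Suc_right)
    qed
    moreover have "0 < c / C" using c(1) C(1) by simp
    ultimately show ?case by blast
  qed
  \<comment> \<open>The unspecified threshold \<open>start\<close> is removed by shrinking the
    constant: for the finitely many \<open>n\<close> below it the argument is pushed under
    \<open>e / 2\<close>, where the strict inequality at 0 persists.\<close>
  have small: "\<exists>c>0. \<forall>n\<ge>3 * j + 4. reaches (Suc r) j n (j - d) (c * g n)" if j: "j \<in> {3..6}" for j
  proof -
    have "\<exists>c start. 0 < c \<and> (\<forall>n\<ge>start. reaches (Suc r) j n (j - d) (c * g n))"
    proof -
      have "j - 3 \<le> 3" "3 + (j - 3) = j" using j by auto
      then show ?thesis using large[of "j - 3"] by metis
    qed
    then obtain c start where c: "0 < c" "\<And>n. start \<le> n \<Longrightarrow> reaches (Suc r) j n (j - d) (c * g n)"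
      by blast
    obtain N where N: "avoidable (Suc r) j (3 * j + 4) N" "twr (j - d) 0 < real N"
      using avoidable_small[OF j d q] by blast
    have "\<forall>\<^sub>F x in at 0. twr (j - d) x < real N"
      using isCont_twr N(2) unfolding isCont_def by (rule order_tendstoD)
    then obtain e where e: "e > 0" "\<And>x. x \<noteq> 0 \<Longrightarrow> dist x 0 < e \<Longrightarrow> twr (j - d) x < real N"
      unfolding eventually_at by auto
    define M where "M = (\<Sum>n<start. g n)"
    have M: "0 \<le> M" "\<And>n. n < start \<Longrightarrow> g n \<le> M"
      unfolding M_def using g0 by (auto intro: sum_nonneg member_le_sum)
    define c' where "c' = min c (e / (2 * (M + 1)))"
    have c': "0 < c'" "c' \<le> c" using c(1) e(1) M(1) by (auto simp: c'_def)
    have "reaches (Suc r) j n (j - d) (c' * g n)" if n: "3 * j + 4 \<le> n" for n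
    proof (cases "start \<le> n")
      case True
      then show ?thesis using reaches_mono[OF c(2)] c'(2) g0 by (simp add: mult_right_mono)
    next
      case False
      have "c' * g n \<le> e / (2 * (M + 1)) * M"
        using M False g0 e(1) by (intro mult_mono) (auto simp: c'_def)
      also have "\<dots> \<le> e / 2" using M(1) e(1) by (simp add: field_simps)
      finally have "reaches (Suc r) j (3 * j + 4) (j - d) (e / 2) \<Longrightarrow> ?thesis"
        using reaches_mono n by blast
      moreover have "twr (j - d) (e / 2) < real N" using e(1) by (intro e(2)) auto
      ultimately show ?thesis using N(1) unfolding reaches_def by (meson less_imp_le)
    qed
    then show ?thesis using c'(1) by blast
  qed
  obtain c where c: "\<And>j. j \<in> {3..6} \<Longrightarrow> 0 < c j"
    "\<And>j n. j \<in> {3..6} \<Longrightarrow> 3 * j + 4 \<le> n \<Longrightarrow> reaches (Suc r) j n (j - d) (c j * g n)"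
    using small by metis
  \<comment> \<open>The division by \<open>C\<close> pays in advance for replacing
    \<open>g n\<close> by \<open>g m\<close> at uniformity 6.\<close>
  define e where "e = Min (c ` {3..6}) / C"
  have e: "0 < e" using c(1) C(1) by (simp add: e_def)
  have ec: "e * C \<le> c j" if "j \<in> {3..6}" for j using that C(1) by (simp add: e_def)
  have ec': "e \<le> c j" if "j \<in> {3..6}" for j
  proof -
    have "e * 1 \<le> e * C" using e C(1) by (intro mult_left_mono) auto
    then show ?thesis using ec[OF that] by simp
  qed
  have main: "reaches (Suc r) j n (j - d) (e * g n)" if j: "3 \<le> j" "3 * j + 4 \<le> n" for j n
  proof (cases "j \<le> 6")
    case True
    then have "j \<in> {3..6}" using j by auto
    then show ?thesis using reaches_mono[OF c(2)] ec' g0 j(2) by (simp add: mult_right_mono)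
  next
    case False
    \<comment> \<open>From \<open>j = 6\<close> on, \<open>i\<close> pairs of steps cost
      \<open>5 * i\<close>, whereas \<open>n\<close> exceeds \<open>6 * i\<close> by at least 22; so
      \<open>n - 5 * i\<close> is at least 22 and at least \<open>n / 6\<close>. For odd
      \<open>j\<close> a single step of cost 3 is added.\<close>
    define i where "i = (j - 6) div 2"
    have red: "reaches (Suc r) 6 m (6 - d) (e * g n)" if m: "22 \<le> m" "n \<le> 6 * m" for m
    proof -
      have "e * g n \<le> e * (C * g m)" using e C(2)[OF m] by simp
      also have "\<dots> \<le> c 6 * g m" using mult_right_mono[OF ec[of 6] g0[of m]] by (simp add: mult.assoc)
      finally show ?thesis using reaches_mono[OF c(2)[of 6 m]] m(1) by simp
    qed
    show ?thesis
    proof (cases "even j")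
      case True
      then have ji: "j = 6 + 2 * i" using False by (auto simp: i_def elim!: evenE)
      have "reaches (Suc r) (6 + 2 * i) (n - 5 * i + 5 * i) (6 - d + 2 * i) (e * g n)"
        using j(2) d by (intro reaches_iterate red q) (auto simp: ji)
      moreover have "n - 5 * i + 5 * i = n" "6 - d + 2 * i = j - d" using j(2) ji d by auto
      ultimately show ?thesis using ji by metis
    next
      case odd: False
      then have ji: "j = Suc (6 + 2 * i)" using False by (auto simp: i_def elim!: oddE)
      define m where "m = n - 5 * i - 3"
      have m: "22 \<le> m" "n \<le> 6 * m" "n = m + 5 * i + 3" using j(2) by (auto simp: m_def ji)
      have "reaches (Suc r) (6 + 2 * i) (m + 5 * i) (6 - d + 2 * i) (e * g n)"
        using m d by (intro reaches_iterate red q) auto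
      then have "reaches (Suc r) (Suc (6 + 2 * i)) (m + 5 * i + 3) (Suc (6 - d + 2 * i)) (e * g n)"
        using m(1) d q by (intro reaches_step_tight(1)) auto
      moreover have "Suc (6 - d + 2 * i) = j - d" using ji d by auto
      ultimately show ?thesis using ji m(3) by metis
    qed
  qed
  have "twr (k - Suc d) (e * g n) \<le> real (path_ramsey k (k + r) n)"
    if "4 \<le> k" "3 * k < n" for k n
  proof -
    have "reaches (Suc r) (k - 1) n (k - 1 - d) (e * g n)" using that by (intro main) auto
    from reaches_path_ramsey[OF this] show ?thesis using that by simp
  qed
  then show ?thesis using e by blast
qed

lemma le_double_div:
  fixes k x :: nat
  assumes "0 < k" "k \<le> x"
  shows "x \<le> 2 * (k * (x div k))"
proof -
  have "k * 1 \<le> k * (x div k)"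
    using assms div_le_mono[of k x k] by (intro mult_le_mono2) simp
  moreover have "x mod k < k" "k * (x div k) + x mod k = x" using assms(1) by simp_all
  ultimately show ?thesis by linarith
qed

section \<open>Numerical base bounds and the choice of the constant\<close>

lemma avoidable_graph:
  assumes "4 \<le> m"
  shows "avoidable 2 2 (2 * m) (2 ^ (m div 4))"
proof (rule avoidable_random)
  have "even (m * (m - 1))" by (cases "even m") auto
  then have c: "2 * (m choose 2) = m * (m - 1)" by (simp only: choose_two dvd_mult_div_cancel)
  have "4 * (m div 4 * m) \<le> m * m" by simp
  moreover have "m * (m - 1) = m * m - m" by (simp add: diff_mult_distrib2)
  moreover have "4 * m \<le> m * m" using assms by simp
  ultimately show "m div 4 * m + 1 < m choose 2" using c assms by linarith
qed

lemma avoidable_triples: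
  assumes "6 \<le> m"
  shows "avoidable 2 3 (2 * m) (2 ^ (m\<^sup>2 div 24))"
proof (rule avoidable_random)
  have "3 * (m choose 3) = m * ((m - 1) choose 2)"
    using times_binomial_minus1_eq[of 3 m] by simp
  moreover have "2 * ((m - 1) choose 2) = (m - 1) * (m - 2)"
    using times_binomial_minus1_eq[of 2 "m - 1"] by (simp add: numeral_2_eq_2)
  ultimately have c: "6 * (m choose 3) = m * ((m - 1) * (m - 2))" by (metis mult.left_commute mult_numeral_left(1) num_double numeral_times_numeral mult.assoc)
  obtain l where l: "m = l + 6" using assms by (metis le_add_diff_inverse2)
  have "m * m \<le> 2 * ((m - 1) * (m - 2))" by (simp add: l algebra_simps)
  then have "m * (m * m) \<le> m * (2 * ((m - 1) * (m - 2)))" by (rule mult_le_mono2)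
  also have "m * (2 * ((m - 1) * (m - 2))) = 12 * (m choose 3)" using c by (simp only: mult.left_commute[of m 2])
  finally have "m * (m * m) \<le> 12 * (m choose 3)" .
  moreover have "24 * (m\<^sup>2 div 24 * m) \<le> m * (m * m)"
  proof -
    have "24 * (m\<^sup>2 div 24) * m \<le> m\<^sup>2 * m" by (intro mult_le_mono1) simp
    then show ?thesis by (simp add: power2_eq_square algebra_simps)
  qed
  moreover have "6 * (6 * 6) \<le> m * (m * m)" using assms by (intro mult_le_mono) auto
  ultimately show "m\<^sup>2 div 24 * m + 1 < m choose 3" by linarith
qed

lemma twr_le_two_power:
  assumes "x \<le> real a"
  shows "twr 2 x \<le> real (2 ^ a)" "twr 3 x \<le> real (2 ^ 2 ^ a)"
proof -
  have "twr 1 x \<le> real a" using assms by simp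
  from twr_Suc_le[OF _ this] show t: "twr 2 x \<le> real (2 ^ a)" by (simp add: eval_nat_numeral)
  from twr_Suc_le[OF _ this] show "twr 3 x \<le> real (2 ^ 2 ^ a)" by (simp add: eval_nat_numeral)
qed

lemma reaches_base_four:
  assumes "16 \<le> n"
  shows "reaches 4 3 n 3 (1 / 32 * real n)"
proof -
  have "avoidable 4 3 (2 * (2 * (n div 4))) (2 ^ 2 ^ (n div 4 div 4))"
    using assms by (intro avoidable_four_colours avoidable_graph) auto
  then have av: "avoidable 4 3 n (2 ^ 2 ^ (n div 4 div 4))"
    by (rule avoidable_mono) auto
  have "n \<le> 32 * (n div 4 div 4)"
    using le_double_div[of 16 n] assms by (simp flip: div_mult2_eq)
  then have "1 / 32 * real n \<le> real (n div 4 div 4)" by linarith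
  note bound = twr_le_two_power[OF this]
  show ?thesis by (rule reachesI[OF av bound(2)])
qed

lemma reaches_base_two:
  assumes "12 \<le> n"
  shows "reaches 2 3 n 2 (1 / 432 * (real n)\<^sup>2)"
proof -
  define m where "m = n div 2"
  have m: "6 \<le> m" "2 * m \<le> n" "n \<le> 3 * m" using assms by (auto simp: m_def)
  have av: "avoidable 2 3 n (2 ^ (m\<^sup>2 div 24))"
    using avoidable_mono[OF avoidable_triples[OF m(1)] m(2)] by simp
  have "1 / 432 * (real n)\<^sup>2 \<le> real (m\<^sup>2 div 24)"
  proof -
    have "n\<^sup>2 \<le> 9 * m\<^sup>2" using power_mono[OF m(3), of 2] by (simp add: power_mult_distrib)
    moreover have "36 \<le> m\<^sup>2" using power_mono[OF m(1), of 2] by simp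
    ultimately have "n\<^sup>2 \<le> 432 * (m\<^sup>2 div 24)" using le_double_div[of 24 "m\<^sup>2"] by linarith
    then have "real (n\<^sup>2) \<le> real (432 * (m\<^sup>2 div 24))" by (simp only: of_nat_le_iff)
    then show ?thesis by simp
  qed
  note bound = twr_le_two_power[OF this]
  show ?thesis by (rule reachesI[OF av bound(1)])
qed

lemma reaches_base_three:
  assumes "512 \<le> n"
  shows "reaches 3 3 n 3 (1 / 288 * (log 2 (real n))\<^sup>2)"
proof -
  obtain s where s: "8 ^ s \<le> n" "n < 8 ^ (s + 1)" using ex_power_ivl1[of 8 n] assms by auto
  have "s \<ge> 3"
  proof (rule ccontr)
    assume "\<not> 3 \<le> s"
    then have "(8::nat) ^ (s + 1) \<le> 8 ^ 3" by (intro power_increasing) auto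
    then show False using s(2) assms by simp
  qed
  \<comment> \<open>One factor 8 is given up to absorb the 3 in
    \<open>3 * (2 ^ (3 * t) + 2)\<close>.\<close>
  define t where "t = s - 1"
  have t: "2 \<le> t" "s = Suc t" using \<open>3 \<le> s\<close> by (auto simp: t_def)
  have "(8::nat) ^ 2 \<le> 8 ^ t" using t(1) by (intro power_increasing) auto
  then have "3 * (2 ^ (3 * t) + 2) \<le> n" using s(1) t(2) by (simp add: power_mult)
  then have av: "avoidable 3 3 n (2 ^ 2 ^ (t\<^sup>2 div 4))"
    using avoidable_mono[OF avoidable_three_colours[OF t(1)]] by blast
  have "1 / 288 * (log 2 (real n))\<^sup>2 \<le> real (t\<^sup>2 div 4)"
  proof -
    have "real n \<le> real (8 ^ (s + 1))" using s(2) by (simp only: of_nat_le_iff)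
    also have "\<dots> = 2 powr (3 * (real t + 2))"
    proof -
      have "(8::real) ^ (s + 1) = 2 ^ (3 * (t + 2))" unfolding power_mult using t(2) by simp
      also have "\<dots> = 2 powr real (3 * (t + 2))" by (rule powr_realpow[symmetric]) simp
      finally show ?thesis by (simp add: algebra_simps)
    qed
    finally have "log 2 (real n) \<le> 3 * (real t + 2)" using assms by (simp add: log_le_iff)
    also have "\<dots> \<le> 6 * real t" using t(1) by simp
    finally have "(log 2 (real n))\<^sup>2 \<le> (6 * real t)\<^sup>2" using assms by (intro power_mono) auto
    also have "\<dots> = 36 * real (t\<^sup>2)" by (simp add: power_mult_distrib)
    also have "\<dots> \<le> 288 * real (t\<^sup>2 div 4)"
    proof -
      have "2\<^sup>2 \<le> t\<^sup>2" using t(1) by (intro power_mono) auto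
      then have "36 * t\<^sup>2 \<le> 288 * (t\<^sup>2 div 4)" using le_double_div[of 4 "t\<^sup>2"] by simp
      then have "real (36 * t\<^sup>2) \<le> real (288 * (t\<^sup>2 div 4))" by (simp only: of_nat_le_iff)
      then show ?thesis by simp
    qed
    finally show ?thesis by simp
  qed
  note bound = twr_le_two_power[OF this]
  show ?thesis by (rule reachesI[OF av bound(2)])
qed

lemma path_ramsey_three_four:
  assumes "2 \<le> n"
  shows "2 powr (1 / 16 * real n) < real (path_ramsey 3 4 n)"
proof (cases "8 \<le> n")
  case True
  have "avoidable 2 2 n (2 ^ (n div 2 div 4))"
    using avoidable_mono[OF avoidable_graph[of "n div 2"], of n] True by simp
  then have "2 ^ (n div 2 div 4) < path_ramsey 3 4 n"
    using path_ramsey_greater[of 2 2 n] by simp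
  moreover have "n \<le> 16 * (n div 2 div 4)"
    using le_double_div[of 8 n] True by (simp flip: div_mult2_eq)
  then have "1 / 16 * real n \<le> real (n div 2 div 4)" by linarith
  then have "2 powr (1 / 16 * real n) \<le> real (2 ^ (n div 2 div 4))"
    using twr_le_two_power(1)[of "1 / 16 * real n" "n div 2 div 4"] by (simp add: numeral_2_eq_2)
  ultimately show ?thesis by (meson of_nat_less_iff order_le_less_trans)
next
  \<comment> \<open>For \<open>n < 8\<close> the exponent is below 1, while having fewer than
    \<open>n\<close> vertices already gives the lower bound 2.\<close>
  case False
  have "avoidable 2 2 n (n - 1)" using assms by (intro avoidable_trivial) auto
  then have "n - 1 < path_ramsey 3 4 n"
    using path_ramsey_greater[of 2 2 n] by simp
  then have "2 \<le> path_ramsey 3 4 n" using assms by simp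
  moreover have "2 powr (1 / 16 * real n) < 2 powr 1" using False by (intro powr_less_mono) auto
  ultimately show ?thesis by simp
qed

theorem theorem3:
  shows "\<exists>c::real. c > 0 \<and>
    (\<forall>n::nat. n \<ge> 2 \<longrightarrow> real (path_ramsey 3 4 n) > 2 powr (c * real n)) \<and>
    (\<forall>k n :: nat. k \<ge> 4 \<and> n > 3 * k \<longrightarrow>
       real (path_ramsey k (k + 3) n) \<ge> twr (k - 1) (c * real n) \<and>
       real (path_ramsey k (k + 2) n) \<ge> twr (k - 1) (c * (log 2 (real n))\<^sup>2) \<and>
       real (path_ramsey k (k + 1) n) \<ge> twr (k - 2) (c * (real n)\<^sup>2))"
proof -
  have "\<exists>c>0. \<forall>k n. 4 \<le> k \<longrightarrow> 3 * k < n \<longrightarrow>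
      twr (k - Suc 0) (c * real n) \<le> real (path_ramsey k (k + 3) n)"
    by (rule path_ramsey_tower[where C = 6 and start = 16 and rate = "1 / 32"])
       (use reaches_base_four in auto)
  then obtain c1 where c1: "c1 > 0" "\<And>k n. 4 \<le> k \<Longrightarrow> 3 * k < n \<Longrightarrow>
      twr (k - Suc 0) (c1 * real n) \<le> real (path_ramsey k (k + 3) n)"
    by blast
  have "\<exists>c>0. \<forall>k n. 4 \<le> k \<longrightarrow> 3 * k < n \<longrightarrow>
      twr (k - Suc 0) (c * (log 2 (real n))\<^sup>2) \<le> real (path_ramsey k (k + 2) n)"
  proof (rule path_ramsey_tower[where C = 4 and start = 512 and rate = "1 / 288"])
    fix m n :: nat assume m: "22 \<le> m" "n \<le> 6 * m"
    show "(log 2 (real n))\<^sup>2 \<le> 4 * (log 2 (real m))\<^sup>2"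
    proof (cases "n = 0")
      case False
      \<comment> \<open>A constant factor in \<open>n\<close> is at most a squaring for
        \<open>m \<ge> 22\<close>, so the logarithm at most doubles; this gives
        \<open>C = 4\<close>.\<close>
      have "n \<le> m\<^sup>2" using m by (simp add: power2_eq_square order_trans[OF _ mult_le_mono1])
      then have "real n \<le> (real m)\<^sup>2" by (simp flip: of_nat_power)
      then have "log 2 (real n) \<le> log 2 ((real m)\<^sup>2)" using False m(1) by simp
      also have "\<dots> = 2 * log 2 (real m)" using m(1) by (simp add: log_nat_power)
      finally have "(log 2 (real n))\<^sup>2 \<le> (2 * log 2 (real m))\<^sup>2"
        using False by (intro power_mono) auto
      then show ?thesis by (simp add: power_mult_distrib)
    \<comment> \<open>For \<open>n = 0\<close> the convention \<open>ln 0 = 0\<close> makes the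
      left-hand side vanish.\<close>
    qed (simp add: log_def)
  qed (use reaches_base_three in auto)
  then obtain c2 where c2: "c2 > 0" "\<And>k n. 4 \<le> k \<Longrightarrow> 3 * k < n \<Longrightarrow>
      twr (k - Suc 0) (c2 * (log 2 (real n))\<^sup>2) \<le> real (path_ramsey k (k + 2) n)"
    by blast
  have "\<exists>c>0. \<forall>k n. 4 \<le> k \<longrightarrow> 3 * k < n \<longrightarrow>
      twr (k - Suc 1) (c * (real n)\<^sup>2) \<le> real (path_ramsey k (k + 1) n)"
  proof (rule path_ramsey_tower[where C = 36 and start = 12 and rate = "1 / 432"])
    fix m n :: nat assume "n \<le> 6 * m"
    then have "(real n)\<^sup>2 \<le> (6 * real m)\<^sup>2" by (intro power_mono) auto
    then show "(real n)\<^sup>2 \<le> 36 * (real m)\<^sup>2" by (simp add: power_mult_distrib)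
  qed (use reaches_base_two in \<open>auto simp: numeral_2_eq_2\<close>)
  then obtain c3 where c3: "c3 > 0" "\<And>k n. 4 \<le> k \<Longrightarrow> 3 * k < n \<Longrightarrow>
      twr (k - Suc 1) (c3 * (real n)\<^sup>2) \<le> real (path_ramsey k (k + 1) n)"
    by blast
  define c where "c = min (1 / 16) (min c1 (min c2 c3))"
  have c: "0 < c" "c \<le> 1 / 16" "c \<le> c1" "c \<le> c2" "c \<le> c3"
    using c1(1) c2(1) c3(1) by (auto simp: c_def)
  show ?thesis
  proof (intro exI[of _ c] conjI allI impI)
    fix n :: nat assume "2 \<le> n"
    have "2 powr (c * real n) \<le> 2 powr (1 / 16 * real n)"
      using c(2) by (intro powr_mono mult_right_mono) auto
    then show "real (path_ramsey 3 4 n) > 2 powr (c * real n)"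
      using path_ramsey_three_four[OF \<open>2 \<le> n\<close>] by linarith
  next
    fix k n :: nat assume "4 \<le> k \<and> 3 * k < n"
    then have kn: "4 \<le> k" "3 * k < n" by blast+
    show "twr (k - 1) (c * real n) \<le> real (path_ramsey k (k + 3) n)"
    proof -
      have "twr (k - Suc 0) (c * real n) \<le> twr (k - Suc 0) (c1 * real n)"
        using c(3) by (intro twr_mono mult_right_mono) auto
      then show ?thesis using c1(2)[OF kn] by (simp add: numeral_2_eq_2)
    qed
    show "twr (k - 1) (c * (log 2 (real n))\<^sup>2) \<le> real (path_ramsey k (k + 2) n)"
    proof -
      have "twr (k - Suc 0) (c * (log 2 (real n))\<^sup>2) \<le> twr (k - Suc 0) (c2 * (log 2 (real n))\<^sup>2)"
        using c(4) by (intro twr_mono mult_right_mono) auto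
      then show ?thesis using c2(2)[OF kn] by (simp add: numeral_2_eq_2)
    qed
    show "twr (k - 2) (c * (real n)\<^sup>2) \<le> real (path_ramsey k (k + 1) n)"
    proof -
      have "twr (k - Suc 1) (c * (real n)\<^sup>2) \<le> twr (k - Suc 1) (c3 * (real n)\<^sup>2)"
        using c(5) by (intro twr_mono mult_right_mono) auto
      then show ?thesis using c3(2)[OF kn] by (simp add: numeral_2_eq_2)
    qed
  qed (rule c(1))
qed

end
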